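(* There is a bijective correspondence between the primitive right ideals of $\mathbb{I}$ and the primitive similar sublattices (SSLs) of $L$, defined by $p\,\mathbb{I}\mapsto p\,L\,\widetilde{p}$ (for $p\in\mathbb{I}$ primitive). Furthermore, one has the index formula $$[\mathbb{I}:p\,\mathbb{I}]=\mathrm{N}\bigl(\mathrm{nr}(p)^2\bigr)=\mathrm{N}\bigl(|p|^4\bigr)=[L:p\,L\,\widetilde{p}\,]$$ under this correspondence.
   Context: Let $K=\mathbb{Q}(\sqrt5)\subset\mathbb{R}$, with nontrivial Galois automorphism $\alpha\mapsto\alpha'$ ($\sqrt5\mapsto-\sqrt5$), norm $\mathrm{N}(\alpha)=\alpha\alpha'$, and let $\tau=(1+\sqrt5)/2$, so that $\mathbb{Z}[\tau]$ is the ring of integers of $K$. $\mathbb{H}(K)$ is the Hamilton quaternion algebra over $K$ with basis $1,\mathrm{i},\mathrm{j},\mathrm{k}$, $\mathrm{i}^2=\mathrm{j}^2=\mathrm{k}^2=\mathrm{i}\mathrm{j}\mathrm{k}=-1$; write $x=(x_0,x_1,x_2,x_3)=x_0+x_1\mathrm{i}+x_2\mathrm{j}+x_3\mathrm{k}$, $\bar{x}=(x_0,-x_1,-x_2,-x_3)$, and $\mathrm{nr}(x)=x\bar{x}=|x|^2$. The twist map on $\mathbb{H}(K)$ is $\widetilde{x}=(x_0',x_1',x_3',x_2')$ (all coordinates are conjugated and the last two are swapped). The icosian ring is the maximal order $\mathbb{I}=\langle(1,0,0,0),(0,1,0,0),\tfrac12(1,1,1,1),\tfrac12(1-\tau,\tau,0,1)\rangle_{\mathbb{Z}[\tau]}$.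 The lattice $L\subset\mathbb{R}^4\simeq\mathbb{H}(\mathbb{R})$ is $L=\langle(1,0,0,0),\tfrac12(-1,1,1,1),(0,-1,0,0),\tfrac12(0,1,\tau-1,-\tau)\rangle_{\mathbb{Z}}$ (a scaled copy of the root lattice $A_4$). An element $p\in\mathbb{I}$ is primitive if every $\alpha\in\mathbb{Z}[\tau]$ with $p\in\alpha\mathbb{I}$ is a unit of $\mathbb{Z}[\tau]$; a right ideal of $\mathbb{I}$ is primitive if it is of the form $p\mathbb{I}$ with $p\in\mathbb{I}$ primitive. An SSL of $L$ is a sublattice of the form $SL\subset L$, where $S$ is a linear map of $\mathbb{R}^4$ with $\langle Su|Sv\rangle=c\langle u|v\rangle$ for all $u,v\in\mathbb{R}^4$ and some $c>0$. A sublattice $\Lambda\subset L$ is primitive if $\Lambda\subset mL$ with $m\in\mathbb{N}$ implies $m=1$. *)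

theory Defs
  imports "HOL-Analysis.Analysis" "HOL-Computational_Algebra.Primes"
begin

section \<open>The quadratic field\<close>

(* Unspecified outside the field of all a + b * sqrt 5 with a, b rational. *)
definition galois :: "real \<Rightarrow> real" where
  "galois \<alpha> = (THE \<beta>. \<exists>a\<in>\<rat>. \<exists>b\<in>\<rat>. \<alpha> = a + b * sqrt 5 \<and> \<beta> = a - b * sqrt 5)"

definition field_norm :: "real \<Rightarrow> real" where
  "field_norm \<alpha> = \<alpha> * galois \<alpha>"

definition tau :: real where
  "tau = (1 + sqrt 5) / 2"

definition Z_tau :: "real set" where
  "Z_tau = {a + b * tau | a b. a \<in> \<int> \<and> b \<in> \<int>}"

lemma rat_sqrt5_unique:
  fixes a b c d :: real
  assumes "a \<in> \<rat>" "b \<in> \<rat>" "c \<in> \<rat>" "d \<in> \<rat>" and eq: "a + b * sqrt 5 = c + d * sqrt 5"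
  shows "a = c \<and> b = d"
proof -
  have irr: "sqrt 5 \<notin> \<rat>"
  proof
    assume "sqrt 5 \<in> \<rat>"
    then obtain m n :: nat where n: "n \<noteq> 0" and mn: "\<bar>sqrt 5\<bar> = real m / real n" and cop: "coprime m n"
      by (rule Rats_abs_nat_div_natE)
    from n mn have "real m = sqrt 5 * real n"
      by (simp add: field_simps)
    then have "real (m\<^sup>2) = real (5 * n\<^sup>2)"
      by (simp add: power_mult_distrib)
    then have sq: "m\<^sup>2 = 5 * n\<^sup>2"
      by (simp only: of_nat_eq_iff)
    have p5: "prime (5::nat)" by simp
    from sq have "5 dvd m\<^sup>2" by simp
    with p5 have m5: "5 dvd m" by (rule prime_dvd_power)
    then obtain l where "m = 5 * l" ..
    with sq have "n\<^sup>2 = 5 * l\<^sup>2" by (simp add: power_mult_distrib)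
    then have "5 dvd n\<^sup>2" by simp
    with p5 have "5 dvd n" by (rule prime_dvd_power)
    with m5 have "5 dvd gcd m n" by (rule gcd_greatest)
    with cop show False by simp
  qed
  have "b = d"
  proof (rule ccontr)
    assume "b \<noteq> d"
    with eq have "sqrt 5 = (c - a) / (b - d)"
      by (simp add: field_simps)
    moreover have "(c - a) / (b - d) \<in> \<rat>"
      using assms by (intro Rats_divide Rats_diff)
    ultimately show False using irr by simp
  qed
  with eq show ?thesis by simp
qed

lemma galois_eq:
  fixes a b :: real
  assumes "a \<in> \<rat>" "b \<in> \<rat>"
  shows "galois (a + b * sqrt 5) = a - b * sqrt 5"
  unfolding galois_def
proof (rule the_equality)
  show "\<exists>c\<in>\<rat>. \<exists>d\<in>\<rat>. a + b * sqrt 5 = c + d * sqrt 5 \<and> a - b * sqrt 5 = c - d * sqrt 5"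
    using assms by blast
next
  fix \<beta>
  assume "\<exists>c\<in>\<rat>. \<exists>d\<in>\<rat>. a + b * sqrt 5 = c + d * sqrt 5 \<and> \<beta> = c - d * sqrt 5"
  then show "\<beta> = a - b * sqrt 5"
    using rat_sqrt5_unique assms by blast
qed

section \<open>Hamilton quaternions\<close>

(* The real quaternion x0 + x1 i + x2 j + x3 k is the vector with components
   x $ 1 = x0, x $ 2 = x1, x $ 3 = x2, x $ 4 = x3; the componentwise product
   that the library puts on real ^ 4 is not used. *)
type_synonym quat = "real ^ 4"

definition quat :: "real \<Rightarrow> real \<Rightarrow> real \<Rightarrow> real \<Rightarrow> quat" where
  "quat a b c d = vector [a, b, c, d]"

definition qmult :: "quat \<Rightarrow> quat \<Rightarrow> quat" (infixl "\<star>" 70) where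
  "x \<star> y = quat
     (x $ 1 * y $ 1 - x $ 2 * y $ 2 - x $ 3 * y $ 3 - x $ 4 * y $ 4)
     (x $ 1 * y $ 2 + x $ 2 * y $ 1 + x $ 3 * y $ 4 - x $ 4 * y $ 3)
     (x $ 1 * y $ 3 - x $ 2 * y $ 4 + x $ 3 * y $ 1 + x $ 4 * y $ 2)
     (x $ 1 * y $ 4 + x $ 2 * y $ 3 - x $ 3 * y $ 2 + x $ 4 * y $ 1)"

definition qconj :: "quat \<Rightarrow> quat" where
  "qconj x = quat (x $ 1) (- (x $ 2)) (- (x $ 3)) (- (x $ 4))"

(* The product of x with its conjugate is a real quaternion; nr takes its real part. *)
definition nr :: "quat \<Rightarrow> real" where
  "nr x = (x \<star> qconj x) $ 1"

(* Meaningful for quaternions whose components lie in the field generated by sqrt 5. *)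
definition twist :: "quat \<Rightarrow> quat" where
  "twist x = quat (galois (x $ 1)) (galois (x $ 2)) (galois (x $ 4)) (galois (x $ 3))"

lemma quat_nth [simp]:
  "quat a b c d $ 1 = a" "quat a b c d $ 2 = b" "quat a b c d $ 3 = c" "quat a b c d $ 4 = d"
  by (simp_all add: quat_def vector_def)

lemma quat_eq_iff: "x = y \<longleftrightarrow> x $ 1 = y $ 1 \<and> x $ 2 = y $ 2 \<and> x $ 3 = y $ 3 \<and> x $ 4 = (y :: quat) $ 4"
  by (simp add: vec_eq_iff forall_4)

lemma quat_units:
  defines "i \<equiv> quat 0 1 0 0" and "j \<equiv> quat 0 0 1 0" and "k \<equiv> quat 0 0 0 1"
  shows "i \<star> i = quat (-1) 0 0 0" "j \<star> j = quat (-1) 0 0 0" "k \<star> k = quat (-1) 0 0 0"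
    "(i \<star> j) \<star> k = quat (-1) 0 0 0"
  by (simp_all add: i_def j_def k_def qmult_def quat_eq_iff)

lemma qmult_qconj: "x \<star> qconj x = quat (nr x) 0 0 0"
  by (simp add: nr_def qmult_def qconj_def quat_eq_iff)

lemma nr_eq_norm: "nr x = (norm x)\<^sup>2"
  by (simp add: nr_def qmult_def qconj_def power2_norm_eq_inner inner_vec_def sum_4)

section \<open>The icosian ring and the lattice\<close>

definition span4 :: "real set \<Rightarrow> quat \<Rightarrow> quat \<Rightarrow> quat \<Rightarrow> quat \<Rightarrow> quat set" where
  "span4 R u v w z =
     {a *\<^sub>R u + b *\<^sub>R v + c *\<^sub>R w + d *\<^sub>R z | a b c d. a \<in> R \<and> b \<in> R \<and> c \<in> R \<and> d \<in> R}"

definition icosians :: "quat set" where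
  "icosians = span4 Z_tau
     (quat 1 0 0 0)
     (quat 0 1 0 0)
     ((1/2) *\<^sub>R quat 1 1 1 1)
     ((1/2) *\<^sub>R quat (1 - tau) tau 0 1)"

definition lattice_L :: "quat set" where
  "lattice_L = span4 \<int>
     (quat 1 0 0 0)
     ((1/2) *\<^sub>R quat (-1) 1 1 1)
     (quat 0 (-1) 0 0)
     ((1/2) *\<^sub>R quat 0 1 (tau - 1) (- tau))"

(* The number of cosets x + H with x in G. It is 0 if this number is infinite. *)
definition add_index :: "quat set \<Rightarrow> quat set \<Rightarrow> nat" where
  "add_index G H = card ((\<lambda>x. (+) x ` H) ` G)"

section \<open>Primitive right ideals\<close>

definition unit_Z_tau :: "real \<Rightarrow> bool" where
  "unit_Z_tau \<alpha> \<longleftrightarrow> \<alpha> \<in> Z_tau \<and> (\<exists>\<beta>\<in>Z_tau. \<alpha> * \<beta> = 1)"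

definition primitive_icosian :: "quat \<Rightarrow> bool" where
  "primitive_icosian p \<longleftrightarrow>
     p \<in> icosians \<and> (\<forall>\<alpha>\<in>Z_tau. p \<in> (*\<^sub>R) \<alpha> ` icosians \<longrightarrow> unit_Z_tau \<alpha>)"

definition right_ideal :: "quat set \<Rightarrow> bool" where
  "right_ideal J \<longleftrightarrow>
     J \<subseteq> icosians \<and> 0 \<in> J \<and> (\<forall>x\<in>J. \<forall>y\<in>J. x - y \<in> J) \<and> (\<forall>x\<in>J. \<forall>r\<in>icosians. x \<star> r \<in> J)"

definition principal_right_ideal :: "quat \<Rightarrow> quat set" where
  "principal_right_ideal p = (\<lambda>x. p \<star> x) ` icosians"

definition primitive_right_ideals :: "quat set set" where
  "primitive_right_ideals =
     {J. right_ideal J \<and> (\<exists>p. primitive_icosian p \<and> J = principal_right_ideal p)}"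

section \<open>Primitive similar sublattices\<close>

definition linear_similarity :: "(quat \<Rightarrow> quat) \<Rightarrow> bool" where
  "linear_similarity S \<longleftrightarrow> linear S \<and> (\<exists>c>0. \<forall>u v. S u \<bullet> S v = c * (u \<bullet> v))"

definition similar_sublattice :: "quat set \<Rightarrow> bool" where
  "similar_sublattice \<Lambda> \<longleftrightarrow> (\<exists>S. linear_similarity S \<and> \<Lambda> = S ` lattice_L \<and> \<Lambda> \<subseteq> lattice_L)"

definition primitive_sublattice :: "quat set \<Rightarrow> bool" where
  "primitive_sublattice \<Lambda> \<longleftrightarrow>
     (\<forall>m::nat. 0 < m \<longrightarrow> \<Lambda> \<subseteq> (*\<^sub>R) (real m) ` lattice_L \<longrightarrow> m = 1)"

definition primitive_SSLs :: "quat set set" where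
  "primitive_SSLs = {\<Lambda>. similar_sublattice \<Lambda> \<and> primitive_sublattice \<Lambda>}"

definition twisted_sublattice :: "quat \<Rightarrow> quat set" where
  "twisted_sublattice p = (\<lambda>x. p \<star> x \<star> twist p) ` lattice_L"

end

theory Submission
  imports Defs
begin

text \<open>
The twist reverses products and conjugates coefficients, and \<open>L\<close> is exactly the set of icosians
that it fixes (\<open>lattice_L_iff\<close>). For an icosian \<open>p\<close> and \<open>x\<close> in \<open>L\<close> the product
\<open>p x twist(p)\<close> is fixed again, so \<open>p L twist(p)\<close> is a similar sublattice of \<open>L\<close>.

Primitivity is controlled by the trace form \<open>trd (x y)\<close>. The icosians are self-dual for this form and
\<open>Z[tau]\<close> is a principal ideal domain, so \<open>p\<close> is primitive if and only if \<open>trd (p u) = 1\<close> for some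
icosian \<open>u\<close> (\<open>icosian_content\<close>, \<open>primitive_icosian_trd\<close>). For a basis \<open>e\<^sub>k\<close> with dual basis
\<open>e\<^sub>k*\<close> the sum of all \<open>e\<^sub>k z e\<^sub>k*\<close> is the scalar \<open>trd z\<close>; with \<open>z = p u\<close> this shows that the
two-sided ideal generated by a primitive \<open>p\<close> contains 1, the global form of the fact that the
algebra is split at every finite prime. Hence, if an integer \<open>m\<close> divides all \<open>p x twist(p)\<close> with
\<open>x\<close> in \<open>L\<close>, the factor \<open>p\<close> on the left can be stripped off: \<open>m\<close> divides \<open>sqrt 5 twist(p)\<close>, where
\<open>sqrt 5\<close> appears because \<open>L\<close> spans over \<open>Z[tau]\<close> only a sublattice of the icosians, which contains
\<open>sqrt 5\<close> times all of them. Then \<open>m\<close> divides \<open>sqrt 5\<close> itself and \<open>m = 1\<close>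
(\<open>primitive_icosian_twisted_divisor\<close>).

Every primitive SSL arises in this way. A similarity \<open>S\<close> divided by \<open>S(1)\<close> is orthogonal and fixes 1,
so up to quaternion conjugation, which preserves \<open>L\<close>, it is an algebra automorphism. As \<open>L\<close> spans
the quaternions over \<open>K\<close>, this automorphism is defined over \<open>K\<close> and is inner by an explicit form of
the Skolem-Noether theorem (\<open>quaternion_intertwiner\<close>); thus \<open>S L = r L s\<close> with \<open>r\<close> and \<open>s\<close> over \<open>K\<close>.
Twist-invariance of \<open>r L s\<close> forces \<open>s\<close> to be a rational multiple of \<open>twist(r)\<close>
(\<open>two_sided_imp_twisted\<close>). Replacing \<open>r\<close> by a primitive icosian \<open>q\<close> in \<open>K r\<close> gives a rational
multiple of \<open>q L twist(q)\<close>, and primitivity of both lattices leaves only the factors 1 and -1.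

Two primitive icosians with the same sublattice generate the same right ideal
(\<open>twisted_sublattice_eq_imp_generator\<close>): the primitive part \<open>y\<close> of \<open>qconj(q) p\<close> satisfies
\<open>e y l twist(y) = 1\<close> for some integer \<open>e\<close> and some \<open>l\<close> in \<open>L\<close>, so it is a unit of the icosian ring.

For the indices, multiplication by \<open>p\<close> followed by multiplication by its conjugate is multiplication by
a scalar, whose index is a power of \<open>N(nr p)\<close>. A nonzero icosian \<open>t\<close> with \<open>t p = qconj(p) t\<close> shows that
\<open>p\<close> and its conjugate give the same index, which therefore is the square root of the index of
the scalar. The same argument applies to \<open>x \<mapsto> p x twist(p)\<close> on \<open>L\<close>.
\<close>

section \<open>The quadratic field and its ring of integers\<close>

definition Q_sqrt5 :: "real set" where
  "Q_sqrt5 = {a + b * sqrt 5 | a b. a \<in> \<rat> \<and> b \<in> \<rat>}"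

lemma Q_sqrt5_I: "a \<in> \<rat> \<Longrightarrow> b \<in> \<rat> \<Longrightarrow> a + b * sqrt 5 \<in> Q_sqrt5"
  unfolding Q_sqrt5_def by blast

lemma Q_sqrt5_E:
  assumes "x \<in> Q_sqrt5"
  obtains a b where "a \<in> \<rat>" "b \<in> \<rat>" "x = a + b * sqrt 5"
  using assms unfolding Q_sqrt5_def by blast

lemma Rats_imp_Q_sqrt5: "a \<in> \<rat> \<Longrightarrow> a \<in> Q_sqrt5"
  using Q_sqrt5_I[of a 0] by simp

lemma sqrt5_in_Q_sqrt5: "sqrt 5 \<in> Q_sqrt5"
  using Q_sqrt5_I[of 0 1] by simp

lemma Q_sqrt5_add: "x \<in> Q_sqrt5 \<Longrightarrow> y \<in> Q_sqrt5 \<Longrightarrow> x + y \<in> Q_sqrt5"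
  and galois_add: "x \<in> Q_sqrt5 \<Longrightarrow> y \<in> Q_sqrt5 \<Longrightarrow> galois (x + y) = galois x + galois y"
proof -
  assume "x \<in> Q_sqrt5" "y \<in> Q_sqrt5"
  then obtain a b c d where r: "a \<in> \<rat>" "b \<in> \<rat>" "c \<in> \<rat>" "d \<in> \<rat>"
    and xy: "x = a + b * sqrt 5" "y = c + d * sqrt 5"
    by (metis Q_sqrt5_E)
  have "x + y = (a + c) + (b + d) * sqrt 5"
    by (simp add: xy algebra_simps)
  moreover have "a + c \<in> \<rat>" "b + d \<in> \<rat>" using r by auto
  ultimately show "x + y \<in> Q_sqrt5" "galois (x + y) = galois x + galois y"
    using r by (simp_all only: Q_sqrt5_I galois_eq) (simp add: xy r galois_eq algebra_simps)
qed

lemma Q_sqrt5_mult: "x \<in> Q_sqrt5 \<Longrightarrow> y \<in> Q_sqrt5 \<Longrightarrow> x * y \<in> Q_sqrt5"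
  and galois_mult: "x \<in> Q_sqrt5 \<Longrightarrow> y \<in> Q_sqrt5 \<Longrightarrow> galois (x * y) = galois x * galois y"
proof -
  assume "x \<in> Q_sqrt5" "y \<in> Q_sqrt5"
  then obtain a b c d where r: "a \<in> \<rat>" "b \<in> \<rat>" "c \<in> \<rat>" "d \<in> \<rat>"
    and xy: "x = a + b * sqrt 5" "y = c + d * sqrt 5"
    by (metis Q_sqrt5_E)
  have "x * y = (a * c + 5 * b * d) + (a * d + b * c) * sqrt 5"
    by (simp add: xy algebra_simps)
  moreover have "a * c + 5 * b * d \<in> \<rat>" "a * d + b * c \<in> \<rat>" using r by auto
  ultimately show "x * y \<in> Q_sqrt5" "galois (x * y) = galois x * galois y"
    using r by (simp_all only: Q_sqrt5_I galois_eq) (simp add: xy r galois_eq algebra_simps)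
qed

lemma galois_Rats: "a \<in> \<rat> \<Longrightarrow> galois a = a"
  using galois_eq[of a 0] by simp

lemma galois_minus: "x \<in> Q_sqrt5 \<Longrightarrow> galois (- x) = - galois x"
  using galois_mult[of "-1" x] galois_Rats[of "-1"] by (simp add: Rats_imp_Q_sqrt5)

lemma Q_sqrt5_minus: "x \<in> Q_sqrt5 \<Longrightarrow> - x \<in> Q_sqrt5"
  using Q_sqrt5_mult[of "-1" x] by (simp add: Rats_imp_Q_sqrt5)

lemma Q_sqrt5_diff: "x \<in> Q_sqrt5 \<Longrightarrow> y \<in> Q_sqrt5 \<Longrightarrow> x - y \<in> Q_sqrt5"
  using Q_sqrt5_add[of x "- y"] Q_sqrt5_minus by simp

lemma galois_diff:
  "x \<in> Q_sqrt5 \<Longrightarrow> y \<in> Q_sqrt5 \<Longrightarrow> galois (x - y) = galois x - galois y"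
  using galois_add[of x "- y"] by (simp add: galois_minus Q_sqrt5_minus)

lemma galois_in_Q_sqrt5: "x \<in> Q_sqrt5 \<Longrightarrow> galois x \<in> Q_sqrt5"
  and galois_galois: "x \<in> Q_sqrt5 \<Longrightarrow> galois (galois x) = x"
proof -
  assume "x \<in> Q_sqrt5"
  then obtain a b where r: "a \<in> \<rat>" "b \<in> \<rat>" and x: "x = a + b * sqrt 5" by (rule Q_sqrt5_E)
  have "galois x = a + (- b) * sqrt 5" using r by (simp add: x galois_eq)
  moreover have "galois (a + (- b) * sqrt 5) = x"
    using r galois_eq[of a "- b"] by (simp add: x)
  ultimately show "galois x \<in> Q_sqrt5" "galois (galois x) = x"
    using r Q_sqrt5_I[of a "- b"] by auto
qed

lemma galois_eq_0_iff: "x \<in> Q_sqrt5 \<Longrightarrow> galois x = 0 \<longleftrightarrow> x = 0"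
  using galois_galois galois_Rats[of 0] by force

lemma galois_fixed_imp_Rats:
  assumes "x \<in> Q_sqrt5" "galois x = x"
  shows "x \<in> \<rat>"
  using assms by (auto elim!: Q_sqrt5_E simp: galois_eq)

lemma field_norm_in_Rats: "x \<in> Q_sqrt5 \<Longrightarrow> field_norm x \<in> \<rat>"
  unfolding field_norm_def
  by (rule galois_fixed_imp_Rats)
    (simp_all add: Q_sqrt5_mult galois_in_Q_sqrt5 galois_mult galois_galois mult.commute)

lemma field_norm_mult:
  "x \<in> Q_sqrt5 \<Longrightarrow> y \<in> Q_sqrt5 \<Longrightarrow> field_norm (x * y) = field_norm x * field_norm y"
  by (simp add: field_norm_def galois_mult)

lemma field_norm_eq_0_iff: "x \<in> Q_sqrt5 \<Longrightarrow> field_norm x = 0 \<longleftrightarrow> x = 0"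
  by (simp add: field_norm_def galois_eq_0_iff)

lemma Q_sqrt5_inverse:
  assumes "x \<in> Q_sqrt5"
  shows "inverse x \<in> Q_sqrt5"
proof (cases "x = 0")
  case False
  then have "inverse x = inverse (field_norm x) * galois x"
    using assms by (simp add: field_norm_def galois_eq_0_iff)
  moreover have "inverse (field_norm x) \<in> Q_sqrt5"
    using field_norm_in_Rats[OF assms] by (intro Rats_imp_Q_sqrt5 Rats_inverse)
  ultimately show ?thesis
    using assms by (simp add: Q_sqrt5_mult galois_in_Q_sqrt5)
qed (use assms in simp)

lemma Q_sqrt5_divide: "x \<in> Q_sqrt5 \<Longrightarrow> y \<in> Q_sqrt5 \<Longrightarrow> x / y \<in> Q_sqrt5"
  unfolding divide_inverse by (intro Q_sqrt5_mult Q_sqrt5_inverse)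

lemmas Q_sqrt5_closed =
  Q_sqrt5_add Q_sqrt5_diff Q_sqrt5_minus Q_sqrt5_mult Q_sqrt5_divide galois_in_Q_sqrt5

lemma tau_sq: "tau * tau = tau + 1"
  by (simp add: tau_def field_simps)

lemma tau_sq_left: "tau * (tau * x) = tau * x + x"
  by (metis distrib_right mult.assoc mult_1 tau_sq)

lemma sqrt5_eq: "sqrt 5 = 2 * tau - 1"
  by (simp add: tau_def field_simps)

lemma tau_in_Q_sqrt5: "tau \<in> Q_sqrt5"
  using Q_sqrt5_I[of "1/2" "1/2"] by (simp add: tau_def field_simps)

lemma galois_tau: "galois tau = 1 - tau"
  using galois_eq[of "1/2" "1/2"] by (simp add: tau_def field_simps)

lemma galois_tau_coordinates:
  "a \<in> \<rat> \<Longrightarrow> b \<in> \<rat> \<Longrightarrow> galois (a + b * tau) = a + b * (1 - tau)"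
  by (simp add: galois_add galois_mult galois_Rats galois_tau Q_sqrt5_mult tau_in_Q_sqrt5
      Rats_imp_Q_sqrt5)

lemma Z_tau_I: "a \<in> \<int> \<Longrightarrow> b \<in> \<int> \<Longrightarrow> a + b * tau \<in> Z_tau"
  unfolding Z_tau_def by blast

lemma Z_tau_E:
  assumes "x \<in> Z_tau"
  obtains a b where "a \<in> \<int>" "b \<in> \<int>" "x = a + b * tau"
  using assms unfolding Z_tau_def by blast

lemma Ints_imp_Q_sqrt5: "a \<in> \<int> \<Longrightarrow> a \<in> Q_sqrt5"
  by (metis Ints_cases Rats_imp_Q_sqrt5 Rats_of_int)

lemma Z_tau_imp_Q_sqrt5: "x \<in> Z_tau \<Longrightarrow> x \<in> Q_sqrt5"
  by (erule Z_tau_E) (simp add: Q_sqrt5_closed tau_in_Q_sqrt5 Ints_imp_Q_sqrt5)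

lemma Ints_imp_Z_tau: "a \<in> \<int> \<Longrightarrow> a \<in> Z_tau"
  using Z_tau_I[of a 0] by simp

lemma Z_tau_0 [simp]: "0 \<in> Z_tau" and Z_tau_1 [simp]: "1 \<in> Z_tau"
  and Z_tau_numeral [simp]: "numeral n \<in> Z_tau"
  by (simp_all add: Ints_imp_Z_tau)

lemma tau_in_Z_tau [simp]: "tau \<in> Z_tau"
  using Z_tau_I[of 0 1] by simp

lemma Z_tau_add: "x \<in> Z_tau \<Longrightarrow> y \<in> Z_tau \<Longrightarrow> x + y \<in> Z_tau"
proof (elim Z_tau_E)
  fix a b c d :: real
  assume "a \<in> \<int>" "b \<in> \<int>" "c \<in> \<int>" "d \<in> \<int>" and xy: "x = a + b * tau" "y = c + d * tau"
  then have "(a + c) + (b + d) * tau \<in> Z_tau" by (intro Z_tau_I) auto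
  then show ?thesis by (simp add: xy algebra_simps)
qed

lemma Z_tau_mult: "x \<in> Z_tau \<Longrightarrow> y \<in> Z_tau \<Longrightarrow> x * y \<in> Z_tau"
proof (elim Z_tau_E)
  fix a b c d :: real
  assume "a \<in> \<int>" "b \<in> \<int>" "c \<in> \<int>" "d \<in> \<int>" and xy: "x = a + b * tau" "y = c + d * tau"
  then have "(a * c + b * d) + (a * d + b * c + b * d) * tau \<in> Z_tau" by (intro Z_tau_I) auto
  then show ?thesis by (simp add: xy algebra_simps tau_sq tau_sq_left)
qed

lemma Z_tau_minus: "x \<in> Z_tau \<Longrightarrow> - x \<in> Z_tau"
  using Z_tau_mult[of "-1" x] by (simp add: Ints_imp_Z_tau)

lemma Z_tau_diff: "x \<in> Z_tau \<Longrightarrow> y \<in> Z_tau \<Longrightarrow> x - y \<in> Z_tau"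
  using Z_tau_add[of x "- y"] Z_tau_minus by simp

lemma Ints_imp_Rats: "a \<in> \<int> \<Longrightarrow> a \<in> \<rat>"
  by (metis Ints_cases Rats_of_int)

lemma Z_tau_galois: "x \<in> Z_tau \<Longrightarrow> galois x \<in> Z_tau"
proof (elim Z_tau_E)
  fix a b :: real
  assume ab: "a \<in> \<int>" "b \<in> \<int>" and x: "x = a + b * tau"
  then have "galois x = a + b * (1 - tau)"
    by (simp add: galois_tau_coordinates Ints_imp_Rats)
  then show ?thesis
    using ab by (simp add: Z_tau_add Z_tau_mult Z_tau_diff Ints_imp_Z_tau[of a] Ints_imp_Z_tau[of b])
qed

lemmas Z_tau_closed = Z_tau_add Z_tau_diff Z_tau_minus Z_tau_mult Z_tau_galois

lemma tau_coordinates_unique: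
  assumes "a \<in> \<rat>" "b \<in> \<rat>" "c \<in> \<rat>" "d \<in> \<rat>" "a + b * tau = c + d * tau"
  shows "a = c" "b = d"
proof -
  have "(a + b / 2) + (b / 2) * sqrt 5 = (c + d / 2) + (d / 2) * sqrt 5"
    using assms(5) by (simp add: tau_def field_simps)
  then have "a + b / 2 = c + d / 2 \<and> b / 2 = d / 2"
    by (rule rat_sqrt5_unique[rotated -1]) (use assms in auto)
  then show "a = c" "b = d" by auto
qed

text \<open>
\<open>Z_tau\<close> contains no rational numbers other than integers: this is what turns membership in the
icosians into integrality of the coordinates with respect to the basis of the lattice.
\<close>

lemma Z_tau_Rats_imp_Ints:
  assumes "x \<in> Z_tau" "x \<in> \<rat>"
  shows "x \<in> \<int>"
proof -
  obtain a b where ab: "a \<in> \<int>" "b \<in> \<int>" "x = a + b * tau"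
    using assms(1) by (rule Z_tau_E)
  then have "a = x"
    using assms(2) tau_coordinates_unique(1)[of a b x 0] Ints_imp_Rats by fastforce
  with ab(1) show ?thesis by metis
qed

lemma field_norm_in_Ints: "x \<in> Z_tau \<Longrightarrow> field_norm x \<in> \<int>"
  by (rule Z_tau_Rats_imp_Ints)
    (simp_all add: field_norm_in_Rats Z_tau_imp_Q_sqrt5, simp add: field_norm_def Z_tau_closed)

lemma field_norm_tau_coordinates:
  assumes "a \<in> \<rat>" "b \<in> \<rat>"
  shows "field_norm (a + b * tau) = a\<^sup>2 + a * b - b\<^sup>2"
  unfolding field_norm_def galois_tau_coordinates[OF assms]
  by (simp add: algebra_simps tau_sq tau_sq_left power2_eq_square)

text \<open>
Division with remainder: both coordinates of \<open>a / b\<close> are rounded to the nearest integer, and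
\<open>u\<^sup>2 + u v - v\<^sup>2\<close> is less than 1 in absolute value on the square \<open>\<bar>u\<bar>, \<bar>v\<bar> \<le> 1/2\<close>.
\<close>

lemma Z_tau_euclidean:
  assumes a: "a \<in> Z_tau" and b: "b \<in> Z_tau" "b \<noteq> 0"
  obtains q where "q \<in> Z_tau" "\<bar>field_norm (a - q * b)\<bar> < \<bar>field_norm b\<bar>"
proof -
  have K: "a \<in> Q_sqrt5" "b \<in> Q_sqrt5" using a b by (simp_all add: Z_tau_imp_Q_sqrt5)
  then have "a / b \<in> Q_sqrt5" by (rule Q_sqrt5_divide)
  then obtain r s where rs: "r \<in> \<rat>" "s \<in> \<rat>" "a / b = r + s * sqrt 5" by (rule Q_sqrt5_E)
  define x where "x = r - s"
  define y where "y = 2 * s"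
  have xy: "x \<in> \<rat>" "y \<in> \<rat>" "a / b = x + y * tau"
    using rs by (auto simp: x_def y_def tau_def field_simps)
  define q where "q = of_int (round x) + of_int (round y) * tau"
  have q: "q \<in> Z_tau" unfolding q_def by (rule Z_tau_I) auto
  define u where "u = x - of_int (round x)"
  define v where "v = y - of_int (round y)"
  have uv: "u \<in> \<rat>" "v \<in> \<rat>" using xy by (auto simp: u_def v_def)
  have "\<bar>u\<bar> \<le> 1/2" "\<bar>v\<bar> \<le> 1/2"
    using of_int_round_abs_le[of x] of_int_round_abs_le[of y]
    by (simp_all add: u_def v_def abs_minus_commute)
  then have "u * u \<le> 1/4" "v * v \<le> 1/4" "\<bar>u * v\<bar> \<le> 1/4"
    using mult_mono[of "\<bar>u\<bar>" "1/2" "\<bar>u\<bar>" "1/2"] mult_mono[of "\<bar>v\<bar>" "1/2" "\<bar>v\<bar>" "1/2"]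
      mult_mono[of "\<bar>u\<bar>" "1/2" "\<bar>v\<bar>" "1/2"] by (auto simp: abs_mult)
  moreover have "u * u \<ge> 0" "v * v \<ge> 0" by auto
  ultimately have small: "\<bar>field_norm (u + v * tau)\<bar> < 1"
    unfolding field_norm_tau_coordinates[OF uv] power2_eq_square by linarith
  have "a - q * b = (a / b - q) * b" using b by (simp add: field_simps)
  also have "a / b - q = u + v * tau" by (simp add: xy q_def u_def v_def algebra_simps)
  finally have "field_norm (a - q * b) = field_norm (u + v * tau) * field_norm b"
    using K uv by (simp add: field_norm_mult Q_sqrt5_add Q_sqrt5_mult Rats_imp_Q_sqrt5 tau_in_Q_sqrt5)
  moreover have "\<bar>field_norm b\<bar> > 0" using b K by (simp add: field_norm_eq_0_iff)
  ultimately have "\<bar>field_norm (a - q * b)\<bar> < \<bar>field_norm b\<bar>"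
    using small by (simp add: abs_mult)
  then show thesis using q that by blast
qed

lemma Z_tau_principal:
  assumes sub: "J \<subseteq> Z_tau" and "0 \<in> J"
    and diff: "\<And>x y. x \<in> J \<Longrightarrow> y \<in> J \<Longrightarrow> x - y \<in> J"
    and mult: "\<And>a x. a \<in> Z_tau \<Longrightarrow> x \<in> J \<Longrightarrow> a * x \<in> J"
  obtains g where "g \<in> J" "\<And>x. x \<in> J \<Longrightarrow> \<exists>c\<in>Z_tau. x = c * g"
proof (cases "J = {0}")
  case True
  then have "\<exists>c\<in>Z_tau. x = c * 0" if "x \<in> J" for x
    using that True by (intro bexI[of _ 0]) simp_all
  then show thesis using that[of 0] \<open>0 \<in> J\<close> by blast
next
  case False
  define size where "size x = nat \<lfloor>\<bar>field_norm x\<bar>\<rfloor>" for x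
  have size: "real (size x) = \<bar>field_norm x\<bar>" if "x \<in> Z_tau" for x
    using field_norm_in_Ints[OF that] by (auto simp: size_def elim!: Ints_cases)
  obtain x where "x \<in> J \<and> x \<noteq> 0" using False \<open>0 \<in> J\<close> by blast
  \<comment> \<open>A generator is a nonzero element of least absolute norm.\<close>
  from ex_has_least_nat[of "\<lambda>x. x \<in> J \<and> x \<noteq> 0", OF this, of size]
  obtain g where g: "g \<in> J" "g \<noteq> 0" and least: "\<And>y. y \<in> J \<Longrightarrow> y \<noteq> 0 \<Longrightarrow> size g \<le> size y"
    by blast
  have "\<exists>c\<in>Z_tau. x = c * g" if "x \<in> J" for x
  proof -
    have x: "x \<in> Z_tau" and gZ: "g \<in> Z_tau" using that g sub by auto
    obtain q where q: "q \<in> Z_tau" "\<bar>field_norm (x - q * g)\<bar> < \<bar>field_norm g\<bar>"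
      by (rule Z_tau_euclidean[OF x gZ g(2)])
    have "x - q * g \<in> J" using that g q by (intro diff mult)
    moreover from q have "size (x - q * g) < size g"
      using x gZ size by (metis Z_tau_diff Z_tau_mult of_nat_less_iff)
    ultimately have "x - q * g = 0" using least by force
    then show ?thesis using q by auto
  qed
  then show thesis using that g by blast
qed

section \<open>Quaternions\<close>

lemma nr_mult: "nr (x \<star> y) = nr x * nr y"
  by (simp add: nr_def qmult_def qconj_def algebra_simps)

lemma norm_qmult: "norm (x \<star> y) = norm x * norm y"
  by (rule power2_eq_imp_eq) (simp_all add: power_mult_distrib nr_mult flip: nr_eq_norm)

interpretation qmult: bounded_bilinear qmult
proof
  show "\<exists>K. \<forall>x y. norm (x \<star> y) \<le> norm x * norm y * K"
    by (rule exI[of _ 1]) (simp add: norm_qmult)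
qed (simp_all add: qmult_def quat_eq_iff algebra_simps)

lemma qmult_assoc: "(x \<star> y) \<star> z = x \<star> (y \<star> z)"
  by (simp add: qmult_def quat_eq_iff algebra_simps)

lemma qmult_scalar: "quat a 0 0 0 \<star> x = a *\<^sub>R x" "x \<star> quat a 0 0 0 = a *\<^sub>R x"
  by (simp_all add: qmult_def quat_eq_iff algebra_simps)

lemma qmult_1: "quat 1 0 0 0 \<star> x = x" "x \<star> quat 1 0 0 0 = x"
  by (simp_all add: qmult_scalar)

lemma qconj_qconj [simp]: "qconj (qconj x) = x"
  by (simp add: qconj_def quat_eq_iff)

lemma qmult_qconj_left: "qconj x \<star> x = quat (nr x) 0 0 0"
  by (simp add: nr_def qmult_def qconj_def quat_eq_iff)

lemma nr_qconj [simp]: "nr (qconj x) = nr x"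
  by (simp add: nr_def qmult_def qconj_def)

lemma nr_eq_0_iff: "nr x = 0 \<longleftrightarrow> x = 0"
  by (simp add: nr_eq_norm)

lemma nr_pos: "x \<noteq> 0 \<Longrightarrow> nr x > 0"
  by (simp add: nr_eq_norm)

lemma qmult_qconj_cancel: "qconj x \<star> (x \<star> y) = nr x *\<^sub>R y" "(y \<star> x) \<star> qconj x = nr x *\<^sub>R y"
  "x \<star> (qconj x \<star> y) = nr x *\<^sub>R y"
  by (simp_all add: qmult_assoc qmult_qconj qmult_scalar)
    (simp_all add: qmult_qconj_left qmult_qconj qmult_scalar flip: qmult_assoc)

lemma qmult_eq_0_iff: "x \<star> y = 0 \<longleftrightarrow> x = 0 \<or> y = 0"
  by (simp add: nr_mult flip: nr_eq_0_iff)

lemma inner_qmult_left: "(a \<star> x) \<bullet> (a \<star> y) = nr a * (x \<bullet> y)"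
  by (simp add: nr_def qmult_def qconj_def inner_vec_def sum_4 algebra_simps)

lemma inner_qmult_right: "(x \<star> a) \<bullet> (y \<star> a) = nr a * (x \<bullet> y)"
  by (simp add: nr_def qmult_def qconj_def inner_vec_def sum_4 algebra_simps)

text \<open>
The reduced trace \<open>x + qconj x\<close>, as a real number.
\<close>

definition trd :: "quat \<Rightarrow> real" where
  "trd x = 2 * x $ 1"

lemma trd_diff: "trd (x - y) = trd x - trd y"
  and trd_scaleR: "trd (a *\<^sub>R x) = a * trd x"
  by (simp_all add: trd_def algebra_simps)

lemma qconj_eq_trd: "qconj x = quat (trd x) 0 0 0 - x"
  by (simp add: qconj_def trd_def quat_eq_iff)

definition K_quaternions :: "quat set" where
  "K_quaternions = {x. \<forall>i. x $ i \<in> Q_sqrt5}"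

lemma K_quaternions_iff:
  "x \<in> K_quaternions \<longleftrightarrow> x $ 1 \<in> Q_sqrt5 \<and> x $ 2 \<in> Q_sqrt5 \<and> x $ 3 \<in> Q_sqrt5 \<and> x $ 4 \<in> Q_sqrt5"
  by (simp add: K_quaternions_def forall_4)

lemma K_quaternions_add: "x \<in> K_quaternions \<Longrightarrow> y \<in> K_quaternions \<Longrightarrow> x + y \<in> K_quaternions"
  and K_quaternions_diff: "x \<in> K_quaternions \<Longrightarrow> y \<in> K_quaternions \<Longrightarrow> x - y \<in> K_quaternions"
  and K_quaternions_qmult: "x \<in> K_quaternions \<Longrightarrow> y \<in> K_quaternions \<Longrightarrow> x \<star> y \<in> K_quaternions"
  and K_quaternions_scaleR: "a \<in> Q_sqrt5 \<Longrightarrow> x \<in> K_quaternions \<Longrightarrow> a *\<^sub>R x \<in> K_quaternions"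
  and K_quaternions_qconj: "x \<in> K_quaternions \<Longrightarrow> qconj x \<in> K_quaternions"
  and K_quaternions_twist: "x \<in> K_quaternions \<Longrightarrow> twist x \<in> K_quaternions"
  by (simp_all add: K_quaternions_iff qmult_def qconj_def twist_def Q_sqrt5_closed)

lemmas K_quaternions_closed = K_quaternions_add K_quaternions_diff K_quaternions_qmult
  K_quaternions_scaleR K_quaternions_qconj K_quaternions_twist

lemma K_quaternions_nr: "x \<in> K_quaternions \<Longrightarrow> nr x \<in> Q_sqrt5"
  by (simp add: K_quaternions_iff qmult_def qconj_def nr_def Q_sqrt5_closed)

lemma twist_add:
  "x \<in> K_quaternions \<Longrightarrow> y \<in> K_quaternions \<Longrightarrow> twist (x + y) = twist x + twist y"
  by (simp add: K_quaternions_iff twist_def quat_eq_iff galois_add)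

lemma twist_diff:
  "x \<in> K_quaternions \<Longrightarrow> y \<in> K_quaternions \<Longrightarrow> twist (x - y) = twist x - twist y"
  by (simp add: K_quaternions_iff twist_def quat_eq_iff galois_diff)

lemma twist_scaleR:
  "a \<in> Q_sqrt5 \<Longrightarrow> x \<in> K_quaternions \<Longrightarrow> twist (a *\<^sub>R x) = galois a *\<^sub>R twist x"
  by (simp add: K_quaternions_iff twist_def quat_eq_iff galois_mult)

lemma twist_twist: "x \<in> K_quaternions \<Longrightarrow> twist (twist x) = x"
  by (simp add: K_quaternions_iff twist_def quat_eq_iff galois_galois)

text \<open>
The exchange of \<open>j\<close> and \<open>k\<close> reverses the orientation of the imaginary units, which makes the
twist an anti-automorphism.
\<close>

lemma twist_qmult:
  "x \<in> K_quaternions \<Longrightarrow> y \<in> K_quaternions \<Longrightarrow> twist (x \<star> y) = twist y \<star> twist x"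
  by (simp add: K_quaternions_iff twist_def quat_eq_iff qmult_def galois_add galois_diff galois_mult
      Q_sqrt5_closed algebra_simps)

lemma twist_qconj: "x \<in> K_quaternions \<Longrightarrow> twist (qconj x) = qconj (twist x)"
  by (simp add: K_quaternions_iff twist_def quat_eq_iff qconj_def galois_minus)

lemma nr_twist: "x \<in> K_quaternions \<Longrightarrow> nr (twist x) = galois (nr x)"
  by (simp add: K_quaternions_iff twist_def nr_def qmult_def qconj_def galois_add galois_diff
      galois_mult galois_minus Q_sqrt5_closed algebra_simps)

lemma twist_eq_0_iff: "x \<in> K_quaternions \<Longrightarrow> twist x = 0 \<longleftrightarrow> x = 0"
  using nr_twist K_quaternions_nr galois_eq_0_iff by (metis nr_eq_0_iff)

section \<open>The icosian ring\<close>

definition ico1 :: quat where "ico1 = quat 1 0 0 0"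
definition ico2 :: quat where "ico2 = quat 0 1 0 0"
definition ico3 :: quat where "ico3 = (1/2) *\<^sub>R quat 1 1 1 1"
definition ico4 :: quat where "ico4 = (1/2) *\<^sub>R quat (1 - tau) tau 0 1"

lemmas ico_defs = ico1_def ico2_def ico3_def ico4_def

text \<open>
The basis dual to \<open>ico1\<close>, ..., \<open>ico4\<close> for the trace form \<open>trd (x \<star> y)\<close>.
\<close>

definition dual1 :: quat where "dual1 = (1/2) *\<^sub>R quat 1 0 tau (1 - tau)"
definition dual2 :: quat where "dual2 = (1/2) *\<^sub>R quat 0 (-1) (1 - tau) tau"
definition dual3 :: quat where "dual3 = quat 0 0 (-1) 0"
definition dual4 :: quat where "dual4 = quat 0 0 1 (-1)"

lemmas dual_defs = dual1_def dual2_def dual3_def dual4_def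

lemma dual_expansion:
  "x = trd (x \<star> dual1) *\<^sub>R ico1 + trd (x \<star> dual2) *\<^sub>R ico2
     + trd (x \<star> dual3) *\<^sub>R ico3 + trd (x \<star> dual4) *\<^sub>R ico4"
  by (simp add: quat_eq_iff qmult_def ico_defs dual_defs trd_def field_simps tau_sq tau_sq_left)

lemma icosians_I:
  "a \<in> Z_tau \<Longrightarrow> b \<in> Z_tau \<Longrightarrow> c \<in> Z_tau \<Longrightarrow> d \<in> Z_tau \<Longrightarrow>
    a *\<^sub>R ico1 + b *\<^sub>R ico2 + c *\<^sub>R ico3 + d *\<^sub>R ico4 \<in> icosians"
  unfolding icosians_def span4_def ico_defs by blast

lemma icosians_E:
  assumes "x \<in> icosians"
  obtains a b c d where "a \<in> Z_tau" "b \<in> Z_tau" "c \<in> Z_tau" "d \<in> Z_tau"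
    "x = a *\<^sub>R ico1 + b *\<^sub>R ico2 + c *\<^sub>R ico3 + d *\<^sub>R ico4"
  using assms unfolding icosians_def span4_def ico_defs by blast

lemma icosians_scaleR: "a \<in> Z_tau \<Longrightarrow> x \<in> icosians \<Longrightarrow> a *\<^sub>R x \<in> icosians"
  by (erule icosians_E)
    (simp add: scaleR_add_right icosians_I Z_tau_mult)

lemma icosians_diff:
  assumes "x \<in> icosians" "y \<in> icosians"
  shows "x - y \<in> icosians"
proof -
  obtain a b c d where r: "a \<in> Z_tau" "b \<in> Z_tau" "c \<in> Z_tau" "d \<in> Z_tau"
    and x: "x = a *\<^sub>R ico1 + b *\<^sub>R ico2 + c *\<^sub>R ico3 + d *\<^sub>R ico4"
    using assms(1) by (rule icosians_E)
  obtain a' b' c' d' where r': "a' \<in> Z_tau" "b' \<in> Z_tau" "c' \<in> Z_tau" "d' \<in> Z_tau"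
    and y: "y = a' *\<^sub>R ico1 + b' *\<^sub>R ico2 + c' *\<^sub>R ico3 + d' *\<^sub>R ico4"
    using assms(2) by (rule icosians_E)
  have "x - y = (a - a') *\<^sub>R ico1 + (b - b') *\<^sub>R ico2 + (c - c') *\<^sub>R ico3 + (d - d') *\<^sub>R ico4"
    by (simp add: x y algebra_simps)
  then show ?thesis using r r' by (simp add: icosians_I Z_tau_diff)
qed

lemma icosians_1: "quat 1 0 0 0 \<in> icosians"
  using icosians_I[of 1 0 0 0] by (simp add: ico1_def)

lemma icosians_0: "0 \<in> icosians"
  using icosians_I[of 0 0 0 0] by simp

lemma icosians_minus: "x \<in> icosians \<Longrightarrow> - x \<in> icosians"
  using icosians_diff[of 0 x] by (simp add: icosians_0)

lemma icosians_add: "x \<in> icosians \<Longrightarrow> y \<in> icosians \<Longrightarrow> x + y \<in> icosians"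
  using icosians_diff[of x "- y"] by (simp add: icosians_minus)

lemma icosians_scalar: "a \<in> Z_tau \<Longrightarrow> quat a 0 0 0 \<in> icosians"
  using icosians_scaleR[OF _ icosians_1, of a] by (simp flip: qmult_scalar) (simp add: qmult_1)

text \<open>
The four equations are the multiplication table of the basis. Left multiplication by the basis
elements suffices for closure under products, by linearity in the left factor.
\<close>

lemma icosians_qmult_basis:
  assumes "x \<in> icosians"
  shows "ico1 \<star> x \<in> icosians" "ico2 \<star> x \<in> icosians" "ico3 \<star> x \<in> icosians" "ico4 \<star> x \<in> icosians"
proof -
  obtain a b c d where r: "a \<in> Z_tau" "b \<in> Z_tau" "c \<in> Z_tau" "d \<in> Z_tau"
    and x: "x = a *\<^sub>R ico1 + b *\<^sub>R ico2 + c *\<^sub>R ico3 + d *\<^sub>R ico4"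
    using assms by (rule icosians_E)
  show "ico1 \<star> x \<in> icosians" using assms by (simp add: ico1_def qmult_1)
  have "ico2 \<star> x = (- b + (tau - 1) * c) *\<^sub>R ico1 + (a + (1 - tau) * c + (1 - tau) * d) *\<^sub>R ico2
      + (- c - d) *\<^sub>R ico3 + (2 * c + d) *\<^sub>R ico4"
    by (simp add: x quat_eq_iff qmult_def ico_defs field_simps tau_sq tau_sq_left)
  then show "ico2 \<star> x \<in> icosians"
    by (simp only:) (intro icosians_I Z_tau_closed r; simp)
  have "ico3 \<star> x = (- (tau * b) - c - d) *\<^sub>R ico1 + (tau * b + d) *\<^sub>R ico2
      + (a + b + c) *\<^sub>R ico3 + ((1 - tau) * d - 2 * b) *\<^sub>R ico4"
    by (simp add: x quat_eq_iff qmult_def ico_defs field_simps tau_sq tau_sq_left)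
  then show "ico3 \<star> x \<in> icosians"
    by (simp only:) (intro icosians_I Z_tau_closed r; simp)
  have "ico4 \<star> x = (- (tau * b) - d) *\<^sub>R ico1 + (- c) *\<^sub>R ico2
      + (b + (1 - tau) * c) *\<^sub>R ico3 + (a - b + tau * c + (1 - tau) * d) *\<^sub>R ico4"
    by (simp add: x quat_eq_iff qmult_def ico_defs field_simps tau_sq tau_sq_left)
  then show "ico4 \<star> x \<in> icosians"
    by (simp only:) (intro icosians_I Z_tau_closed r; simp)
qed

lemma icosians_qmult:
  assumes "x \<in> icosians" "y \<in> icosians"
  shows "x \<star> y \<in> icosians"
  using assms(1)
proof (rule icosians_E)
  fix a b c d
  assume r: "a \<in> Z_tau" "b \<in> Z_tau" "c \<in> Z_tau" "d \<in> Z_tau"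
    and x: "x = a *\<^sub>R ico1 + b *\<^sub>R ico2 + c *\<^sub>R ico3 + d *\<^sub>R ico4"
  show ?thesis
    unfolding x qmult.add_left qmult.scaleR_left
    by (intro icosians_add icosians_scaleR icosians_qmult_basis r assms(2))
qed

lemma icosians_trd: "x \<in> icosians \<Longrightarrow> trd x \<in> Z_tau"
proof (erule icosians_E)
  fix a b c d
  assume r: "a \<in> Z_tau" "b \<in> Z_tau" "c \<in> Z_tau" "d \<in> Z_tau"
    and x: "x = a *\<^sub>R ico1 + b *\<^sub>R ico2 + c *\<^sub>R ico3 + d *\<^sub>R ico4"
  have "trd x = 2 * a + c + d * (1 - tau)"
    by (simp add: x trd_def ico_defs field_simps)
  also have "\<dots> \<in> Z_tau" by (intro Z_tau_closed r; simp)
  finally show ?thesis .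
qed

lemma icosians_qconj: "x \<in> icosians \<Longrightarrow> qconj x \<in> icosians"
  unfolding qconj_eq_trd by (intro icosians_diff icosians_scalar icosians_trd)

lemma icosians_imp_K_quaternions: "x \<in> icosians \<Longrightarrow> x \<in> K_quaternions"
  by (erule icosians_E)
    (simp add: K_quaternions_iff ico_defs Q_sqrt5_closed Z_tau_imp_Q_sqrt5)

lemma icosians_nr: "x \<in> icosians \<Longrightarrow> nr x \<in> Z_tau"
proof -
  assume "x \<in> icosians"
  then have "quat (nr x) 0 0 0 \<in> icosians"
    by (simp add: icosians_qmult icosians_qconj flip: qmult_qconj)
  then show ?thesis
    by (rule icosians_E) (auto simp: quat_eq_iff ico_defs)
qed

lemma icosians_dual: "dual1 \<in> icosians" "dual2 \<in> icosians" "dual3 \<in> icosians" "dual4 \<in> icosians"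
proof -
  have d: "dual1 = (-1) *\<^sub>R ico1 + 1 *\<^sub>R ico2 + tau *\<^sub>R ico3 + (1 - 2 * tau) *\<^sub>R ico4"
    "dual2 = 1 *\<^sub>R ico1 + (-2) *\<^sub>R ico2 + (1 - tau) *\<^sub>R ico3 + (2 * tau - 1) *\<^sub>R ico4"
    "dual3 = tau *\<^sub>R ico1 + (1 - tau) *\<^sub>R ico2 + (-2) *\<^sub>R ico3 + 2 *\<^sub>R ico4"
    "dual4 = (1 - 2 * tau) *\<^sub>R ico1 + (2 * tau - 1) *\<^sub>R ico2 + 2 *\<^sub>R ico3 + (-4) *\<^sub>R ico4"
    by (simp_all add: quat_eq_iff ico_defs dual_defs field_simps tau_sq tau_sq_left)
  have neg: "(-1) \<in> Z_tau" "(-2) \<in> Z_tau" "(-4) \<in> Z_tau"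
    by (simp_all add: Ints_imp_Z_tau)
  show "dual1 \<in> icosians"
    by (subst d(1)) (intro icosians_I Z_tau_diff Z_tau_mult; simp add: neg)
  show "dual2 \<in> icosians"
    by (subst d(2)) (intro icosians_I Z_tau_diff Z_tau_mult; simp add: neg)
  show "dual3 \<in> icosians"
    by (subst d(3)) (intro icosians_I Z_tau_diff Z_tau_mult; simp add: neg)
  show "dual4 \<in> icosians"
    by (subst d(4)) (intro icosians_I Z_tau_diff Z_tau_mult; simp add: neg)
qed

lemma icosians_ico: "ico1 \<in> icosians" "ico2 \<in> icosians" "ico3 \<in> icosians" "ico4 \<in> icosians"
  using icosians_I[of 1 0 0 0] icosians_I[of 0 1 0 0] icosians_I[of 0 0 1 0] icosians_I[of 0 0 0 1]
  by simp_all

lemma icosians_quat: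
  assumes "a \<in> Z_tau" "b \<in> Z_tau" "c \<in> Z_tau" "d \<in> Z_tau"
  shows "quat a b c d \<in> icosians"
proof -
  have "quat a b c d = a *\<^sub>R ico1 + b *\<^sub>R ico2 - c *\<^sub>R dual3 - d *\<^sub>R (dual3 + dual4)"
    by (simp add: quat_eq_iff ico_defs dual_defs)
  then show ?thesis
    by (simp only:) (intro icosians_add icosians_diff icosians_scaleR icosians_ico icosians_dual assms)
qed

text \<open>
The dual basis consists of icosians, so the trace form is unimodular: integral traces against all
icosians make the coordinates of \<open>x\<close> integral.
\<close>

lemma icosians_self_dual:
  assumes "\<And>u. u \<in> icosians \<Longrightarrow> trd (x \<star> u) \<in> Z_tau"
  shows "x \<in> icosians"
  by (subst dual_expansion) (intro icosians_I assms icosians_dual)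

text \<open>
The tensor \<open>\<Sum>\<^sub>k e\<^sub>k \<otimes> e\<^sub>k*\<close> is the same for every pair of dual bases. For the basis
\<open>1, i, j, k\<close> with dual \<open>1/2, -i/2, -j/2, -k/2\<close> the left-hand side is
\<open>(z - i z i - j z j - k z k) / 2\<close>, twice the real part of \<open>z\<close>.
\<close>

lemma icosian_casimir:
  "ico1 \<star> z \<star> dual1 + ico2 \<star> z \<star> dual2 + ico3 \<star> z \<star> dual3 + ico4 \<star> z \<star> dual4 = quat (trd z) 0 0 0"
  by (simp add: quat_eq_iff qmult_def ico_defs dual_defs trd_def field_simps tau_sq tau_sq_left)

lemma icosians_twist: "x \<in> icosians \<Longrightarrow> twist x \<in> icosians"
proof (erule icosians_E)
  fix a b c d
  assume r: "a \<in> Z_tau" "b \<in> Z_tau" "c \<in> Z_tau" "d \<in> Z_tau"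
    and x: "x = a *\<^sub>R ico1 + b *\<^sub>R ico2 + c *\<^sub>R ico3 + d *\<^sub>R ico4"
  have K: "a \<in> Q_sqrt5" "b \<in> Q_sqrt5" "c \<in> Q_sqrt5" "d \<in> Q_sqrt5" "1 \<in> Q_sqrt5" "2 \<in> Q_sqrt5"
    using r by (simp_all add: Z_tau_imp_Q_sqrt5)
  have g: "galois (y / 2) = galois y / 2" if "y \<in> Q_sqrt5" for y
    using that galois_mult[of "1/2" y] galois_Rats[of "1/2"] by (simp add: Rats_imp_Q_sqrt5)
  have "twist x = galois a *\<^sub>R ico1 + galois b *\<^sub>R ico2 + (galois c + galois d) *\<^sub>R ico3
      + (- galois d) *\<^sub>R ico4"
    using K tau_in_Q_sqrt5
    by (simp add: x twist_def quat_eq_iff ico_defs galois_add galois_mult galois_diff g galois_tau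
        galois_Rats[of 1] galois_Rats[of 2] Q_sqrt5_closed field_simps)
  then show ?thesis by (simp only:) (intro icosians_I Z_tau_closed r)
qed

lemmas icosians_closed = icosians_add icosians_diff icosians_minus icosians_qmult icosians_scaleR
  icosians_qconj icosians_twist

section \<open>Primitive icosians\<close>

lemma primitive_icosian_if_trd:
  assumes "p \<in> icosians" "u \<in> icosians" "trd (p \<star> u) = 1"
  shows "primitive_icosian p"
  unfolding primitive_icosian_def
proof (intro conjI ballI impI assms(1))
  fix \<alpha> assume \<alpha>: "\<alpha> \<in> Z_tau" and "p \<in> (*\<^sub>R) \<alpha> ` icosians"
  then obtain y where y: "y \<in> icosians" "p = \<alpha> *\<^sub>R y" by blast
  have "\<alpha> * trd (y \<star> u) = 1"
    using assms(3) by (simp add: y qmult.scaleR_left trd_scaleR)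
  then show "unit_Z_tau \<alpha>"
    unfolding unit_Z_tau_def using \<alpha> y assms(2) by (auto intro!: icosians_trd icosians_qmult)
qed

text \<open>
The traces \<open>trd (p \<star> u)\<close> form an ideal of \<open>Z_tau\<close>. By self-duality its generator \<open>g\<close> divides \<open>p\<close>
within the icosians, and dividing by \<open>g\<close> turns the ideal of traces into the unit ideal.
\<close>

lemma icosian_content:
  assumes p: "p \<in> icosians" "p \<noteq> 0"
  obtains g y u where "g \<in> Z_tau" "g \<noteq> 0" "y \<in> icosians" "u \<in> icosians"
    "p = g *\<^sub>R y" "trd (y \<star> u) = 1"
proof -
  define J where "J = (\<lambda>u. trd (p \<star> u)) ` icosians"
  have "J \<subseteq> Z_tau" using p by (auto simp: J_def intro!: icosians_trd icosians_qmult)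
  moreover have "0 \<in> J"
    unfolding J_def by (rule image_eqI[of _ _ 0]) (simp_all add: icosians_0 qmult.zero_right trd_def)
  moreover have "x - y \<in> J" if "x \<in> J" "y \<in> J" for x y
  proof -
    obtain u v where "x = trd (p \<star> u)" "y = trd (p \<star> v)" "u \<in> icosians" "v \<in> icosians"
      using \<open>x \<in> J\<close> \<open>y \<in> J\<close> by (auto simp: J_def)
    then show ?thesis
      unfolding J_def by (intro image_eqI[of _ _ "u - v"]) (simp_all add: qmult.diff_right trd_diff icosians_diff)
  qed
  moreover have "a * x \<in> J" if "a \<in> Z_tau" "x \<in> J" for a x
  proof -
    obtain u where "x = trd (p \<star> u)" "u \<in> icosians" using \<open>x \<in> J\<close> by (auto simp: J_def)
    with that show ?thesis
      unfolding J_def by (intro image_eqI[of _ _ "a *\<^sub>R u"])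
        (simp_all add: qmult.scaleR_right trd_scaleR icosians_scaleR)
  qed
  ultimately obtain g where g: "g \<in> J" and gen: "\<And>x. x \<in> J \<Longrightarrow> \<exists>c\<in>Z_tau. x = c * g"
    using Z_tau_principal[of J] by metis
  have "g \<noteq> 0"
  proof
    assume "g = 0"
    then have "trd (p \<star> u) = 0" if "u \<in> icosians" for u
      using gen[of "trd (p \<star> u)"] that by (auto simp: J_def)
    then have "p = 0" using dual_expansion[of p] by (simp add: icosians_dual)
    with p show False by simp
  qed
  from g obtain u where u: "u \<in> icosians" "g = trd (p \<star> u)" by (auto simp: J_def)
  define y where "y = (1 / g) *\<^sub>R p"
  have py: "p = g *\<^sub>R y" using \<open>g \<noteq> 0\<close> by (simp add: y_def)
  have "y \<in> icosians"
  proof (rule icosians_self_dual)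
    fix v assume "v \<in> icosians"
    then obtain c where "c \<in> Z_tau" "trd (p \<star> v) = c * g" using gen[of "trd (p \<star> v)"] by (auto simp: J_def)
    then show "trd (y \<star> v) \<in> Z_tau"
      using \<open>g \<noteq> 0\<close> by (simp add: y_def qmult.scaleR_left trd_scaleR)
  qed
  moreover have "trd (y \<star> u) = 1"
    using u(2) \<open>g \<noteq> 0\<close> by (simp add: y_def qmult.scaleR_left trd_scaleR)
  moreover have "g \<in> Z_tau" using u p by (simp add: icosians_trd icosians_qmult)
  ultimately show thesis using that py \<open>g \<noteq> 0\<close> u(1) by blast
qed

lemma primitive_icosian_imp_nonzero: "primitive_icosian p \<Longrightarrow> p \<noteq> 0"
proof
  assume "primitive_icosian p" "p = 0"
  moreover have "0 \<in> (*\<^sub>R) 0 ` icosians" using icosians_0 by force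
  ultimately have "unit_Z_tau 0" by (auto simp: primitive_icosian_def)
  then show False by (simp add: unit_Z_tau_def)
qed

text \<open>
Together with \<open>primitive_icosian_if_trd\<close>, this characterises primitivity by the trace form. All
later uses of primitivity go through the witness \<open>u\<close>.
\<close>

lemma primitive_icosian_trd:
  assumes "primitive_icosian p"
  obtains u where "u \<in> icosians" "trd (p \<star> u) = 1"
proof -
  have "p \<in> icosians" "p \<noteq> 0"
    using assms primitive_icosian_imp_nonzero by (simp_all add: primitive_icosian_def)
  then obtain g y u where *: "g \<in> Z_tau" "y \<in> icosians" "u \<in> icosians"
    "p = g *\<^sub>R y" "trd (y \<star> u) = 1"
    by (rule icosian_content)
  then have "unit_Z_tau g" using assms by (auto simp: primitive_icosian_def)
  then obtain h where h: "h \<in> Z_tau" "g * h = 1" by (auto simp: unit_Z_tau_def)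
  have "trd (p \<star> (h *\<^sub>R u)) = 1"
    using h * by (simp add: qmult.scaleR_left qmult.scaleR_right trd_scaleR mult.commute)
  then show thesis using that h * by (blast intro: icosians_scaleR)
qed

lemma Q_sqrt5_denominator:
  assumes "x \<in> Q_sqrt5"
  obtains n :: int where "n \<noteq> 0" "of_int n * x \<in> Z_tau"
proof -
  obtain r s where rs: "r \<in> \<rat>" "s \<in> \<rat>" "x = r + s * sqrt 5" using assms by (rule Q_sqrt5_E)
  obtain a b where ab: "b > 0" "r = of_int a / of_int b" using rs(1) by (metis Rats_cases')
  obtain c d where cd: "d > 0" "s = of_int c / of_int d" using rs(2) by (metis Rats_cases')
  have "of_int (b * d) * x = of_int (a * d) + of_int (b * c) * (2 * tau - 1)"
    unfolding rs(3) ab(2) cd(2) sqrt5_eq using ab(1) cd(1) by (simp add: field_simps)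
  also have "\<dots> \<in> Z_tau"
    by (intro Z_tau_closed Ints_imp_Z_tau[OF Ints_of_int]) simp_all
  finally show thesis using that[of "b * d"] ab cd by simp
qed

lemma K_quaternion_primitive_multiple:
  assumes "x \<in> K_quaternions" "x \<noteq> 0"
  obtains k q where "k \<in> Q_sqrt5" "k \<noteq> 0" "primitive_icosian q" "x = k *\<^sub>R q"
proof -
  have "\<exists>n::int. n \<noteq> 0 \<and> of_int n * (x $ i) \<in> Z_tau" for i
    using assms(1) Q_sqrt5_denominator[of "x $ i"] by (auto simp: K_quaternions_def)
  then obtain n :: "4 \<Rightarrow> int" where n: "\<And>i. n i \<noteq> 0" "\<And>i. of_int (n i) * (x $ i) \<in> Z_tau"
    by metis
  define m where "m = prod n UNIV"
  have m0: "m \<noteq> 0" using n(1) by (simp add: m_def)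
  have m: "of_int m * (x $ i) \<in> Z_tau" for i
  proof -
    have "of_int m * (x $ i) = of_int (prod n (UNIV - {i})) * (of_int (n i) * (x $ i))"
      by (simp add: m_def prod.remove[of UNIV i])
    then show ?thesis using n(2) by (simp only: Z_tau_mult Ints_imp_Z_tau Ints_of_int)
  qed
  have "of_int m *\<^sub>R x = quat (of_int m * x $ 1) (of_int m * x $ 2) (of_int m * x $ 3) (of_int m * x $ 4)"
    by (simp add: quat_eq_iff)
  then have "of_int m *\<^sub>R x \<in> icosians" using m by (simp add: icosians_quat)
  then obtain g y u where *: "g \<in> Z_tau" "g \<noteq> 0" "y \<in> icosians" "u \<in> icosians"
    "of_int m *\<^sub>R x = g *\<^sub>R y" "trd (y \<star> u) = 1"
    using icosian_content[of "of_int m *\<^sub>R x"] assms(2) m0 by auto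
  have "x = (g / of_int m) *\<^sub>R y"
    using arg_cong[OF *(5), of "\<lambda>z. (1 / of_int m) *\<^sub>R z"] m0 by simp
  moreover have "g / of_int m \<in> Q_sqrt5" "g / of_int m \<noteq> 0"
    using * m0 by (simp_all add: Q_sqrt5_divide Z_tau_imp_Q_sqrt5 Rats_imp_Q_sqrt5)
  moreover have "primitive_icosian y" using * primitive_icosian_if_trd by blast
  ultimately show thesis using that by blast
qed

section \<open>The lattice as the twist-invariant icosians\<close>

definition lat1 :: quat where "lat1 = quat 1 0 0 0"
definition lat2 :: quat where "lat2 = (1/2) *\<^sub>R quat (-1) 1 1 1"
definition lat3 :: quat where "lat3 = quat 0 (-1) 0 0"
definition lat4 :: quat where "lat4 = (1/2) *\<^sub>R quat 0 1 (tau - 1) (- tau)"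

lemmas lat_defs = lat1_def lat2_def lat3_def lat4_def

lemma lattice_L_I:
  "a \<in> \<int> \<Longrightarrow> b \<in> \<int> \<Longrightarrow> c \<in> \<int> \<Longrightarrow> d \<in> \<int> \<Longrightarrow>
    a *\<^sub>R lat1 + b *\<^sub>R lat2 + c *\<^sub>R lat3 + d *\<^sub>R lat4 \<in> lattice_L"
  unfolding lattice_L_def span4_def lat_defs by blast

lemma lattice_L_E:
  assumes "x \<in> lattice_L"
  obtains a b c d where "a \<in> \<int>" "b \<in> \<int>" "c \<in> \<int>" "d \<in> \<int>"
    "x = a *\<^sub>R lat1 + b *\<^sub>R lat2 + c *\<^sub>R lat3 + d *\<^sub>R lat4"
  using assms unfolding lattice_L_def span4_def lat_defs by blast

lemma lat_in_lattice_L: "lat1 \<in> lattice_L" "lat2 \<in> lattice_L" "lat3 \<in> lattice_L" "lat4 \<in> lattice_L"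
  using lattice_L_I[of 1 0 0 0] lattice_L_I[of 0 1 0 0] lattice_L_I[of 0 0 1 0] lattice_L_I[of 0 0 0 1]
  by simp_all

lemma lat_icosians: "lat1 \<in> icosians" "lat2 \<in> icosians" "lat3 \<in> icosians" "lat4 \<in> icosians"
proof -
  have l: "lat1 = ico1" "lat2 = ico3 - ico1" "lat3 = - ico2"
    "lat4 = (- 1) *\<^sub>R ico1 + 2 *\<^sub>R ico2 + (tau - 1) *\<^sub>R ico3 + (1 - 2 * tau) *\<^sub>R ico4"
    by (simp_all add: quat_eq_iff ico_defs lat_defs field_simps tau_sq tau_sq_left)
  show "lat1 \<in> icosians" "lat2 \<in> icosians" "lat3 \<in> icosians"
    unfolding l by (intro icosians_closed icosians_ico)+
  show "lat4 \<in> icosians"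
    unfolding l by (intro icosians_I Z_tau_closed; simp)
qed

lemma lat_twist: "twist lat1 = lat1" "twist lat2 = lat2" "twist lat3 = lat3" "twist lat4 = lat4"
proof -
  have g: "galois (1/2) = 1/2" "galois (-1) = -1" "galois (-1/2) = -1/2" "galois 0 = 0" "galois 1 = 1"
    by (simp_all add: galois_Rats)
  have "tau / 2 - 1/2 = - 1/2 + 1/2 * tau" "- (tau / 2) = 0 + (- 1/2) * tau" by simp_all
  then have t: "galois (tau / 2 - 1/2) = - tau / 2" "galois (- (tau / 2)) = tau / 2 - 1/2"
    by (simp_all only: galois_tau_coordinates Rats_0 Rats_divide Rats_minus_iff Rats_1 Rats_number_of)
      (simp_all add: field_simps)
  show "twist lat1 = lat1" "twist lat2 = lat2" "twist lat3 = lat3" "twist lat4 = lat4"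
    using g t by (simp_all add: quat_eq_iff twist_def lat_defs diff_divide_distrib)
qed

text \<open>
For a twist-invariant icosian the first two components are rational and the last two are conjugate.
Writing \<open>x $ 3 = (u + v tau) / 2\<close> fixes the coordinates with respect to the basis of \<open>L\<close>; it remains that
those belonging to \<open>lat1\<close> and \<open>lat3\<close> are integers. They are rational and, up to sign, differ from traces of
icosians by elements of \<open>Z_tau\<close>.
\<close>

lemma lattice_L_iff: "x \<in> lattice_L \<longleftrightarrow> x \<in> icosians \<and> twist x = x"
proof
  assume "x \<in> lattice_L"
  then obtain a b c d where r: "a \<in> \<int>" "b \<in> \<int>" "c \<in> \<int>" "d \<in> \<int>"
    and x: "x = a *\<^sub>R lat1 + b *\<^sub>R lat2 + c *\<^sub>R lat3 + d *\<^sub>R lat4"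
    by (rule lattice_L_E)
  have "x \<in> icosians"
    unfolding x by (intro icosians_add icosians_scaleR lat_icosians Ints_imp_Z_tau r)
  moreover have "twist x = x"
    using r by (simp add: x twist_add twist_scaleR lat_twist K_quaternions_closed
        lat_icosians icosians_imp_K_quaternions Ints_imp_Q_sqrt5 Ints_imp_Rats galois_Rats)
  ultimately show "x \<in> icosians \<and> twist x = x" by simp
next
  assume "x \<in> icosians \<and> twist x = x"
  then have xI: "x \<in> icosians" and tw: "twist x = x" by auto
  have xK: "x \<in> K_quaternions" using xI by (rule icosians_imp_K_quaternions)
  have coord: "trd (x \<star> dual1) \<in> Z_tau" "trd (x \<star> dual2) \<in> Z_tau" "trd (x \<star> dual3) \<in> Z_tau"
    by (intro icosians_trd icosians_qmult xI icosians_dual)+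
  have gal: "galois (x $ 1) = x $ 1" "galois (x $ 2) = x $ 2" "galois (x $ 3) = x $ 4"
    using tw by (simp_all add: twist_def quat_eq_iff)
  have rat: "x $ 1 \<in> \<rat>" "x $ 2 \<in> \<rat>"
    using xK gal by (auto intro!: galois_fixed_imp_Rats simp: K_quaternions_iff)
  have "2 * x $ 3 \<in> Z_tau" using coord(3) by (simp add: trd_def qmult_def dual_defs)
  then obtain u v where uv: "u \<in> \<int>" "v \<in> \<int>" "2 * x $ 3 = u + v * tau" by (rule Z_tau_E)
  have "galois (2 * x $ 3) = 2 * x $ 4"
    using xK gal by (simp add: galois_mult Rats_imp_Q_sqrt5 galois_Rats K_quaternions_iff)
  then have x4: "2 * x $ 4 = u + v * (1 - tau)"
    using uv by (simp add: galois_tau_coordinates Ints_imp_Rats)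
  have x3: "x $ 3 = (u + v * tau) / 2" and x4: "x $ 4 = (u + v * (1 - tau)) / 2"
    using uv(3) x4 by simp_all
  define a where "a = x $ 1 + (u + v) / 2"
  define c where "c = (u + 2 * v) / 2 - x $ 2"
  have "a = trd (x \<star> dual1) + u + 2 * v"
    by (simp add: a_def trd_def qmult_def dual_defs x3 x4 field_simps tau_sq tau_sq_left)
  also have "\<dots> \<in> Z_tau" by (intro Z_tau_closed coord Ints_imp_Z_tau uv; simp)
  finally have "a \<in> Z_tau" .
  moreover have "a \<in> \<rat>" unfolding a_def using rat uv by (simp add: Ints_imp_Rats)
  ultimately have a: "a \<in> \<int>" by (rule Z_tau_Rats_imp_Ints)
  have "c = 2 * v - trd (x \<star> dual2)"
    by (simp add: c_def trd_def qmult_def dual_defs x3 x4 field_simps tau_sq tau_sq_left)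
  also have "\<dots> \<in> Z_tau" by (intro Z_tau_closed coord Ints_imp_Z_tau uv; simp)
  finally have "c \<in> Z_tau" .
  moreover have "c \<in> \<rat>" unfolding c_def using rat uv by (simp add: Ints_imp_Rats)
  ultimately have c: "c \<in> \<int>" by (rule Z_tau_Rats_imp_Ints)
  have "x = a *\<^sub>R lat1 + (u + v) *\<^sub>R lat2 + c *\<^sub>R lat3 + v *\<^sub>R lat4"
    by (simp add: quat_eq_iff lat_defs x3 x4 a_def c_def field_simps)
  then show "x \<in> lattice_L" using a c uv by (simp only: lattice_L_I Ints_add)
qed

lemma lattice_L_icosians: "x \<in> lattice_L \<Longrightarrow> x \<in> icosians"
  and lattice_L_twist: "x \<in> lattice_L \<Longrightarrow> twist x = x"
  and lattice_L_K_quaternions: "x \<in> lattice_L \<Longrightarrow> x \<in> K_quaternions"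
  by (simp_all add: lattice_L_iff icosians_imp_K_quaternions)

lemma lattice_L_1: "quat 1 0 0 0 \<in> lattice_L"
  using lat_in_lattice_L(1) by (simp add: lat1_def)

lemma lattice_L_diff: "x \<in> lattice_L \<Longrightarrow> y \<in> lattice_L \<Longrightarrow> x - y \<in> lattice_L"
  and lattice_L_add: "x \<in> lattice_L \<Longrightarrow> y \<in> lattice_L \<Longrightarrow> x + y \<in> lattice_L"
  and lattice_L_qconj: "x \<in> lattice_L \<Longrightarrow> qconj x \<in> lattice_L"
  by (simp_all add: lattice_L_iff icosians_closed twist_diff twist_add twist_qconj
      icosians_imp_K_quaternions)

lemma lattice_L_scaleR: "a \<in> \<int> \<Longrightarrow> x \<in> lattice_L \<Longrightarrow> a *\<^sub>R x \<in> lattice_L"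
  by (simp add: lattice_L_iff icosians_scaleR Ints_imp_Z_tau twist_scaleR Ints_imp_Q_sqrt5
      icosians_imp_K_quaternions galois_Rats Ints_imp_Rats)

lemma twisted_conjugate_fixed:
  assumes "p \<in> K_quaternions" "x \<in> K_quaternions" "twist x = x"
  shows "twist (p \<star> x \<star> twist p) = p \<star> x \<star> twist p"
  using assms by (simp add: twist_qmult K_quaternions_closed twist_twist qmult_assoc)

lemma lattice_L_twisted_conjugate:
  "p \<in> icosians \<Longrightarrow> x \<in> lattice_L \<Longrightarrow> p \<star> x \<star> twist p \<in> lattice_L"
  by (simp add: lattice_L_iff icosians_closed twisted_conjugate_fixed icosians_imp_K_quaternions)

text \<open>
Over \<open>Z_tau\<close> the lattice spans a proper submodule of the icosians: the coordinates of \<open>ico4\<close> with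
respect to the basis of \<open>L\<close> have the denominator \<open>sqrt 5\<close>, the discriminant of \<open>A\<^sub>4\<close> being 5.
\<close>

lemma sqrt5_icosians_span_L:
  assumes "x \<in> icosians"
  obtains a b c d where "a \<in> Z_tau" "b \<in> Z_tau" "c \<in> Z_tau" "d \<in> Z_tau"
    "sqrt 5 *\<^sub>R x = a *\<^sub>R lat1 + b *\<^sub>R lat2 + c *\<^sub>R lat3 + d *\<^sub>R lat4"
proof -
  obtain a b c d where r: "a \<in> Z_tau" "b \<in> Z_tau" "c \<in> Z_tau" "d \<in> Z_tau"
    and x: "x = a *\<^sub>R ico1 + b *\<^sub>R ico2 + c *\<^sub>R ico3 + d *\<^sub>R ico4"
    using assms by (rule icosians_E)
  have "sqrt 5 *\<^sub>R x = ((2 * tau - 1) * (a + c) + (tau - 2) * d) *\<^sub>R lat1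
      + ((2 * tau - 1) * c + (tau - 1) * d) *\<^sub>R lat2
      + (- ((2 * tau - 1) * b) - 2 * d) *\<^sub>R lat3 + (- d) *\<^sub>R lat4"
    unfolding sqrt5_eq
    by (simp add: x quat_eq_iff ico_defs lat_defs field_simps tau_sq tau_sq_left)
  then show thesis
    by (rule that[rotated -1]) (intro Z_tau_closed r; simp)+
qed

section \<open>Primitive icosians give primitive sublattices\<close>

text \<open>
If \<open>m\<close> divides \<open>p x twist(p)\<close> for all \<open>x\<close> in \<open>L\<close>, it divides \<open>sqrt 5 p x twist(p)\<close> for all
icosians \<open>x\<close>. The Casimir identity applied to \<open>p u\<close> with \<open>trd (p u) = 1\<close> combines these products to
\<open>sqrt 5 twist(p)\<close>. After a twist and one more trace against \<open>u\<close>, \<open>m\<close> divides \<open>sqrt 5 = 2 tau - 1\<close>,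
which has a coordinate of absolute value 1.
\<close>

lemma primitive_icosian_twisted_divisor:
  assumes p: "primitive_icosian p" and m: "m > 0"
    and dvd: "\<And>x. x \<in> lattice_L \<Longrightarrow> p \<star> x \<star> twist p \<in> (*\<^sub>R) (real m) ` lattice_L"
  shows "m = 1"
proof -
  have pI: "p \<in> icosians" using p by (simp add: primitive_icosian_def)
  obtain u where u: "u \<in> icosians" "trd (p \<star> u) = 1" using p by (rule primitive_icosian_trd)
  define M where "M = (*\<^sub>R) (real m) ` icosians"
  have M_add: "x + y \<in> M" if "x \<in> M" "y \<in> M" for x y
    using that by (auto simp: M_def scaleR_add_right[symmetric] intro: icosians_add)
  have M_scaleR: "a *\<^sub>R x \<in> M" if "a \<in> Z_tau" "x \<in> M" for a x
  proof -
    obtain y where "y \<in> icosians" "x = real m *\<^sub>R y" using \<open>x \<in> M\<close> by (auto simp: M_def)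
    then show ?thesis
      unfolding M_def using that by (intro image_eqI[of _ _ "a *\<^sub>R y"]) (simp_all add: icosians_scaleR)
  qed
  have M_qmult: "a \<star> x \<in> M" if "a \<in> icosians" "x \<in> M" for a x
    using that by (auto simp: M_def qmult.scaleR_right intro: icosians_qmult)
  have "p \<star> x \<star> twist p \<in> M" if "x \<in> lattice_L" for x
    using dvd[OF that] lattice_L_icosians by (auto simp: M_def)
  then have lat: "p \<star> x \<star> twist p \<in> M" if "x \<in> {lat1, lat2, lat3, lat4}" for x
    using that lat_in_lattice_L by auto
  have M: "sqrt 5 *\<^sub>R (p \<star> x \<star> twist p) \<in> M" if "x \<in> icosians" for x
  proof -
    obtain a b c d where r: "a \<in> Z_tau" "b \<in> Z_tau" "c \<in> Z_tau" "d \<in> Z_tau"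
      and x: "sqrt 5 *\<^sub>R x = a *\<^sub>R lat1 + b *\<^sub>R lat2 + c *\<^sub>R lat3 + d *\<^sub>R lat4"
      using \<open>x \<in> icosians\<close> by (rule sqrt5_icosians_span_L)
    have "sqrt 5 *\<^sub>R (p \<star> x \<star> twist p) = p \<star> (sqrt 5 *\<^sub>R x) \<star> twist p"
      by (simp add: qmult.scaleR_left qmult.scaleR_right)
    also have "\<dots> \<in> M"
      unfolding x qmult.add_left qmult.add_right qmult.scaleR_left qmult.scaleR_right
      by (intro M_add M_scaleR r lat) simp_all
    finally show ?thesis .
  qed
  define w where "w k = sqrt 5 *\<^sub>R (p \<star> (u \<star> k) \<star> twist p)" for k
  have w: "w k \<in> M" if "k \<in> icosians" for k
    unfolding w_def by (intro M icosians_qmult u that)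
  have "sqrt 5 *\<^sub>R twist p = sqrt 5 *\<^sub>R (quat (trd (p \<star> u)) 0 0 0 \<star> twist p)"
    by (simp add: u qmult_1)
  also have "\<dots> = ico1 \<star> w dual1 + ico2 \<star> w dual2 + ico3 \<star> w dual3 + ico4 \<star> w dual4"
    unfolding w_def icosian_casimir[symmetric]
    by (simp add: qmult.add_left qmult.scaleR_right scaleR_add_right qmult_assoc)
  also have "\<dots> \<in> M"
    by (intro M_add M_qmult w icosians_ico icosians_dual)
  finally obtain y where y: "y \<in> icosians" "sqrt 5 *\<^sub>R twist p = real m *\<^sub>R y"
    by (auto simp: M_def)
  have "galois (sqrt 5) = - sqrt 5" using galois_eq[of 0 1] by simp
  then have "real m *\<^sub>R twist y = - (sqrt 5 *\<^sub>R p)"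
    using arg_cong[OF y(2), of twist] pI y(1)
    by (simp add: twist_scaleR twist_twist icosians_imp_K_quaternions K_quaternions_twist
        Rats_imp_Q_sqrt5 galois_Rats sqrt5_in_Q_sqrt5)
  then have "trd (real m *\<^sub>R twist y \<star> u) = - sqrt 5"
    using u(2) by (simp add: qmult.minus_left qmult.scaleR_left trd_scaleR) (simp add: trd_def)
  then have eq: "real m * trd (twist y \<star> u) = - sqrt 5"
    by (simp add: qmult.scaleR_left trd_scaleR)
  have "trd (twist y \<star> u) \<in> Z_tau" using y u by (simp add: icosians_trd icosians_closed)
  then obtain a b where ab: "a \<in> \<int>" "b \<in> \<int>" "trd (twist y \<star> u) = a + b * tau" by (rule Z_tau_E)
  have "real m * a + real m * b * tau = 1 + (-2) * tau"
    using eq by (simp add: ab(3) sqrt5_eq algebra_simps)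
  then have "real m * a = 1"
    by (rule tau_coordinates_unique(1)[rotated -1]) (use ab in \<open>simp_all add: Ints_imp_Rats\<close>)
  then obtain i :: int where "real m * of_int i = 1" using ab(1) by (auto elim!: Ints_cases)
  then have "int m * i = 1" by (metis of_int_eq_1_iff of_int_mult of_int_of_nat_eq)
  then show "m = 1" using m by (auto simp: zmult_eq_1_iff)
qed

lemma primitive_sublattice_twisted:
  "primitive_icosian p \<Longrightarrow> primitive_sublattice (twisted_sublattice p)"
  unfolding primitive_sublattice_def twisted_sublattice_def
  using primitive_icosian_twisted_divisor by blast

lemma linear_twisted: "linear (\<lambda>x. p \<star> x \<star> q)"
  by (rule linearI) (simp_all add: qmult.add_left qmult.add_right qmult.scaleR_left qmult.scaleR_right)

lemma twisted_sublattice_in_primitive_SSLs: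
  assumes p: "primitive_icosian p"
  shows "twisted_sublattice p \<in> primitive_SSLs"
proof -
  have pI: "p \<in> icosians" and p0: "p \<noteq> 0"
    using p primitive_icosian_imp_nonzero by (auto simp: primitive_icosian_def)
  have "linear_similarity (\<lambda>x. p \<star> x \<star> twist p)"
    unfolding linear_similarity_def
  proof (intro conjI exI[of _ "nr p * nr (twist p)"] allI linear_twisted)
    show "0 < nr p * nr (twist p)"
      using p0 pI by (simp add: nr_pos twist_eq_0_iff icosians_imp_K_quaternions)
  qed (simp add: inner_qmult_left inner_qmult_right)
  moreover have "twisted_sublattice p \<subseteq> lattice_L"
    using pI by (auto simp: twisted_sublattice_def lattice_L_twisted_conjugate)
  ultimately show ?thesis
    using p unfolding primitive_SSLs_def similar_sublattice_def
    using primitive_sublattice_twisted by (auto simp: twisted_sublattice_def)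
qed

text \<open>
For \<open>e = a / b\<close> in lowest terms, a Bezout relation \<open>s a + t b = 1\<close> writes \<open>x\<close> as \<open>b\<close> times the lattice
vector \<open>s (e x) + t x\<close>, so \<open>b\<close> divides \<open>\<Lambda>\<close>.
\<close>

lemma primitive_sublattice_rational_multiple:
  assumes prim: "primitive_sublattice \<Lambda>" and sub: "\<Lambda> \<subseteq> lattice_L"
    and e: "e \<in> \<rat>" "\<And>x. x \<in> \<Lambda> \<Longrightarrow> e *\<^sub>R x \<in> lattice_L"
  shows "e \<in> \<int>"
proof -
  obtain a b where ab: "b > 0" "coprime a b" "e = of_int a / of_int b"
    using e(1) by (metis Rats_cases')
  obtain s t where st: "s * a + t * b = 1" using ab(2) by (metis bezout_int coprime_imp_gcd_eq_1)
  have "x \<in> (*\<^sub>R) (real (nat b)) ` lattice_L" if "x \<in> \<Lambda>" for x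
  proof (rule image_eqI)
    have "of_int b * (of_int s * e + of_int t) = (of_int (s * a + t * b) :: real)"
      using ab by (simp add: field_simps)
    also have "\<dots> = 1" using st by simp
    finally show "x = real (nat b) *\<^sub>R (of_int s *\<^sub>R (e *\<^sub>R x) + of_int t *\<^sub>R x)"
      using ab(1) by (simp flip: scaleR_add_left)
    show "of_int s *\<^sub>R (e *\<^sub>R x) + of_int t *\<^sub>R x \<in> lattice_L"
      by (intro lattice_L_add lattice_L_scaleR Ints_of_int e(2) that subsetD[OF sub that])
  qed
  then have "nat b = 1" using prim ab(1) unfolding primitive_sublattice_def by (metis subsetI zero_less_nat_eq)
  then have "b = 1" using ab(1) by simp
  then show ?thesis using ab by simp
qed

section \<open>Equal sublattices come from equal ideals\<close>

lemma principal_right_ideal_mono: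
  assumes "p \<in> principal_right_ideal q"
  shows "principal_right_ideal p \<subseteq> principal_right_ideal q"
  using assms unfolding principal_right_ideal_def
  by (auto simp: qmult_assoc intro: icosians_qmult)

lemma generator_in_principal_right_ideal: "p \<in> principal_right_ideal p"
  unfolding principal_right_ideal_def
  by (rule image_eqI[OF _ icosians_1]) (simp add: qmult_1)

lemma right_ideal_principal: "p \<in> icosians \<Longrightarrow> right_ideal (principal_right_ideal p)"
  unfolding right_ideal_def principal_right_ideal_def
proof (intro conjI ballI)
  show "0 \<in> (\<star>) p ` icosians"
    by (rule image_eqI[OF _ icosians_0]) (simp add: qmult.zero_right)
qed (auto simp: icosians_closed qmult_assoc simp flip: qmult.diff_right)

lemma twisted_sublattice_mono:
  assumes p: "p \<in> principal_right_ideal q" and q: "q \<in> icosians"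
  shows "twisted_sublattice p \<subseteq> twisted_sublattice q"
proof -
  obtain u where u: "u \<in> icosians" "p = q \<star> u"
    using p by (auto simp: principal_right_ideal_def)
  have "p \<star> x \<star> twist p = q \<star> (u \<star> x \<star> twist u) \<star> twist q" for x
    using u q by (simp add: twist_qmult icosians_imp_K_quaternions qmult_assoc)
  then show ?thesis
    using u(1) by (auto simp: twisted_sublattice_def intro: lattice_L_twisted_conjugate)
qed

lemma twisted_conjugate_scaleR:
  assumes "k \<in> Q_sqrt5" "p \<in> K_quaternions"
  shows "(k *\<^sub>R p) \<star> x \<star> twist (k *\<^sub>R p) = field_norm k *\<^sub>R (p \<star> x \<star> twist p)"
  using assms by (simp add: twist_scaleR qmult.scaleR_left qmult.scaleR_right field_norm_def mult.commute)

lemma twisted_conjugate_conjugate: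
  assumes "q \<in> K_quaternions"
  shows "qconj q \<star> (q \<star> x \<star> twist q) \<star> twist (qconj q) = field_norm (nr q) *\<^sub>R x"
  using assms
  by (simp add: twist_qconj qmult_assoc qmult_qconj qmult_scalar nr_twist)
    (simp add: qmult_qconj_left qmult_scalar field_norm_def qmult.scaleR_right mult.commute flip: qmult_assoc)

text \<open>
Multiplying \<open>p l twist(p) = q l' twist(q)\<close> by the conjugate of \<open>q\<close> on the left and by its twist on the right
gives the same relation between \<open>z = qconj(q) p\<close> and the integer \<open>n = N(nr q)\<close>. With \<open>z = b y\<close> and
\<open>y\<close> primitive, \<open>e = N(b) / n\<close> maps the primitive lattice \<open>y L twist(y)\<close> into \<open>L\<close> and hence is an integer.
As \<open>1\<close> lies in the image, \<open>y\<close> has a right inverse \<open>w\<close> among the icosians. Then \<open>p = c q y\<close> with \<open>c\<close> in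
the quadratic field, and evaluating traces with primitivity of \<open>q\<close> shows that \<open>c\<close> is integral.
\<close>

lemma twisted_sublattice_eq_imp_generator:
  assumes p: "primitive_icosian p" and q: "primitive_icosian q"
    and eq: "twisted_sublattice p = twisted_sublattice q"
  shows "p \<in> principal_right_ideal q"
proof -
  have pI: "p \<in> icosians" and qI: "q \<in> icosians"
    using p q by (simp_all add: primitive_icosian_def)
  note K = icosians_imp_K_quaternions
  have p0: "p \<noteq> 0" and q0: "q \<noteq> 0" using p q primitive_icosian_imp_nonzero by auto
  define n where "n = field_norm (nr q)"
  have n: "n \<in> \<rat>" "n \<noteq> 0"
    using q0 K[OF qI]
    by (simp_all add: n_def field_norm_in_Rats K_quaternions_nr field_norm_eq_0_iff nr_eq_0_iff)
  have "qconj q \<noteq> 0" using q0 by (metis nr_eq_0_iff nr_qconj)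
  then have "qconj q \<star> p \<in> icosians" "qconj q \<star> p \<noteq> 0"
    using pI qI p0 by (simp_all add: icosians_closed qmult_eq_0_iff)
  then obtain b y u where y: "b \<in> Z_tau" "b \<noteq> 0" "y \<in> icosians" "u \<in> icosians"
    "qconj q \<star> p = b *\<^sub>R y" "trd (y \<star> u) = 1"
    by (rule icosian_content)
  define e where "e = field_norm b / n"
  have e: "e \<in> \<rat>"
    using n y by (simp add: e_def field_norm_in_Rats Z_tau_imp_Q_sqrt5)
  have rel: "e *\<^sub>R (y \<star> l \<star> twist y) = l'" if "p \<star> l \<star> twist p = q \<star> l' \<star> twist q" for l l'
  proof -
    have "n *\<^sub>R l' = qconj q \<star> (p \<star> l \<star> twist p) \<star> twist (qconj q)"
      unfolding that n_def using K[OF qI] by (simp add: twisted_conjugate_conjugate)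
    also have "\<dots> = (qconj q \<star> p) \<star> l \<star> twist (qconj q \<star> p)"
      using K[OF qI] K[OF pI] by (simp add: twist_qmult K_quaternions_closed qmult_assoc)
    also have "\<dots> = field_norm b *\<^sub>R (y \<star> l \<star> twist y)"
      unfolding y(5) using y K by (simp add: twisted_conjugate_scaleR Z_tau_imp_Q_sqrt5)
    finally have "(1 / n) *\<^sub>R (n *\<^sub>R l') = (1 / n) *\<^sub>R (field_norm b *\<^sub>R (y \<star> l \<star> twist y))"
      by simp
    then show ?thesis using n by (simp add: e_def)
  qed
  have "e \<in> \<int>"
  proof (rule primitive_sublattice_rational_multiple[OF _ _ e])
    have "primitive_icosian y" using y by (intro primitive_icosian_if_trd)
    then show "primitive_sublattice (twisted_sublattice y)" by (rule primitive_sublattice_twisted)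
    show "twisted_sublattice y \<subseteq> lattice_L"
      using y by (auto simp: twisted_sublattice_def lattice_L_twisted_conjugate)
    fix x assume "x \<in> twisted_sublattice y"
    then obtain l where l: "l \<in> lattice_L" "x = y \<star> l \<star> twist y" by (auto simp: twisted_sublattice_def)
    then have "p \<star> l \<star> twist p \<in> twisted_sublattice q" using eq by (auto simp: twisted_sublattice_def)
    then obtain l' where "l' \<in> lattice_L" "p \<star> l \<star> twist p = q \<star> l' \<star> twist q"
      by (auto simp: twisted_sublattice_def)
    then show "e *\<^sub>R x \<in> lattice_L" using rel l by simp
  qed
  have "q \<star> quat 1 0 0 0 \<star> twist q \<in> twisted_sublattice p"
    using lattice_L_1 eq by (auto simp: twisted_sublattice_def)
  then obtain l where l: "l \<in> lattice_L" "p \<star> l \<star> twist p = q \<star> quat 1 0 0 0 \<star> twist q"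
    by (auto simp: twisted_sublattice_def)
  define w where "w = e *\<^sub>R (l \<star> twist y)"
  have w: "w \<in> icosians"
    unfolding w_def using \<open>e \<in> \<int>\<close> l y
    by (simp add: icosians_closed Ints_imp_Z_tau lattice_L_icosians)
  have yw: "y \<star> w = quat 1 0 0 0"
    using rel[OF l(2)] by (simp add: w_def qmult.scaleR_right qmult_assoc)
  define c where "c = b / nr q"
  have "nr q *\<^sub>R p = b *\<^sub>R (q \<star> y)"
    using qmult_qconj_cancel(3)[of q p] y(5) by (simp add: qmult.scaleR_right)
  then have "(1 / nr q) *\<^sub>R (nr q *\<^sub>R p) = (1 / nr q) *\<^sub>R (b *\<^sub>R (q \<star> y))" by simp
  then have pc: "p = c *\<^sub>R (q \<star> y)" using q0 by (simp add: c_def nr_eq_0_iff)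
  obtain v where v: "v \<in> icosians" "trd (q \<star> v) = 1" using q by (rule primitive_icosian_trd)
  \<comment> \<open>A trace equal to 1 for \<open>q \<star> y\<close>: the inverse \<open>w\<close> removes \<open>y\<close>, leaving the witness for \<open>q\<close>.\<close>
  have "q \<star> y \<star> (w \<star> v) = q \<star> ((y \<star> w) \<star> v)" by (simp add: qmult_assoc)
  then have "q \<star> y \<star> (w \<star> v) = q \<star> v" by (simp add: yw qmult_1)
  then have "trd (p \<star> (w \<star> v)) = c"
    by (simp add: pc qmult.scaleR_left trd_scaleR v)
  moreover have "trd (p \<star> (w \<star> v)) \<in> Z_tau" by (intro icosians_trd icosians_qmult pI w v)
  ultimately have "c \<in> Z_tau" by simp
  then have "c *\<^sub>R y \<in> icosians" using y by (simp add: icosians_scaleR)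
  moreover have "p = q \<star> (c *\<^sub>R y)" by (simp add: pc qmult.scaleR_right)
  ultimately show ?thesis by (auto simp: principal_right_ideal_def)
qed

lemma twisted_sublattice_eq_iff:
  assumes p: "primitive_icosian p" and q: "primitive_icosian q"
  shows "twisted_sublattice p = twisted_sublattice q \<longleftrightarrow>
    principal_right_ideal p = principal_right_ideal q"
proof
  assume "twisted_sublattice p = twisted_sublattice q"
  then have "p \<in> principal_right_ideal q" "q \<in> principal_right_ideal p"
    using twisted_sublattice_eq_imp_generator p q by auto
  then show "principal_right_ideal p = principal_right_ideal q"
    using principal_right_ideal_mono by blast
next
  assume "principal_right_ideal p = principal_right_ideal q"
  then have "p \<in> principal_right_ideal q" "q \<in> principal_right_ideal p"
    using generator_in_principal_right_ideal by blast+
  then show "twisted_sublattice p = twisted_sublattice q"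
    using twisted_sublattice_mono p q by (auto simp: primitive_icosian_def)
qed

section \<open>Every primitive similar sublattice is a twisted one\<close>

text \<open>
The Skolem-Noether theorem for the automorphism \<open>i \<mapsto> v\<close>, \<open>j \<mapsto> w\<close>. Averaging an arbitrary \<open>z\<close> over the
units, as \<open>F z\<close>, produces an intertwiner. Since \<open>\<Sum> e i e\<^sup>-\<^sup>1 = 0\<close> over the units \<open>e = 1, i, j, k\<close>, and likewise
for \<open>j\<close> and \<open>k\<close>, the sum of all \<open>F e e\<^sup>-\<^sup>1\<close> is 4, so some average is nonzero. All of this happens over the
field that contains the entries of \<open>v\<close> and \<open>w\<close>.
\<close>

lemma quaternion_intertwiner:
  assumes K: "v \<in> K_quaternions" "w \<in> K_quaternions"
    and sq: "v \<star> v = - quat 1 0 0 0" "w \<star> w = - quat 1 0 0 0" and anti: "w \<star> v = - (v \<star> w)"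
  obtains q where "q \<in> K_quaternions" "q \<noteq> 0"
    "\<And>x. q \<star> x = (quat (x $ 1) 0 0 0 + (x $ 2) *\<^sub>R v + (x $ 3) *\<^sub>R w + (x $ 4) *\<^sub>R (v \<star> w)) \<star> q"
proof -
  define i j k where ijk: "i = quat 0 1 0 0" "j = quat 0 0 1 0" "k = quat 0 0 0 1"
  define F where "F z = z - v \<star> z \<star> i - w \<star> z \<star> j - v \<star> w \<star> z \<star> k" for z
  have units: "i \<star> i = - quat 1 0 0 0" "j \<star> j = - quat 1 0 0 0" "i \<star> j = k" "j \<star> i = - k"
    "k \<star> i = j" "k \<star> j = - i"
    by (simp_all add: ijk quat_eq_iff qmult_def)
  have vw: "v \<star> (v \<star> z) = - z" "w \<star> (w \<star> z) = - z" "w \<star> (v \<star> z) = - (v \<star> (w \<star> z))" for z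
    using sq anti by (simp_all add: qmult_1 qmult.minus_left flip: qmult_assoc)
  note bilinear = qmult.diff_left qmult.diff_right qmult.minus_left qmult.minus_right
  have Fi: "F z \<star> i = v \<star> F z" for z
    by (simp add: F_def bilinear qmult_assoc units vw qmult_1)
  have Fj: "F z \<star> j = w \<star> F z" for z
    by (simp add: F_def bilinear qmult_assoc units vw qmult_1)
  have Fk: "F z \<star> k = v \<star> w \<star> F z" for z
    by (metis Fi Fj qmult_assoc units(3))
  have intertwines: "F z \<star> x =
      (quat (x $ 1) 0 0 0 + (x $ 2) *\<^sub>R v + (x $ 3) *\<^sub>R w + (x $ 4) *\<^sub>R (v \<star> w)) \<star> F z" for z x
  proof -
    have x: "x = quat (x $ 1) 0 0 0 + (x $ 2) *\<^sub>R i + (x $ 3) *\<^sub>R j + (x $ 4) *\<^sub>R k"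
      by (simp add: quat_eq_iff ijk)
    show ?thesis
      by (subst x) (simp only: qmult.add_left qmult.add_right qmult.scaleR_left qmult.scaleR_right
          Fi Fj Fk qmult_scalar)
  qed
  have "F (quat 1 0 0 0) - F i \<star> i - F j \<star> j - F k \<star> k = quat 4 0 0 0"
    by (simp add: F_def ijk quat_eq_iff qmult_def)
  moreover have "quat 4 0 0 0 \<noteq> 0" by (simp add: quat_eq_iff)
  ultimately obtain z where z: "z \<in> {quat 1 0 0 0, i, j, k}" "F z \<noteq> 0"
    by (metis diff_0_right insertCI qmult.zero_left)
  have ijkK: "quat 1 0 0 0 \<in> K_quaternions" "i \<in> K_quaternions" "j \<in> K_quaternions" "k \<in> K_quaternions"
    by (simp_all add: ijk K_quaternions_iff Rats_imp_Q_sqrt5)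
  have "F z \<in> K_quaternions"
    unfolding F_def using z(1) by (intro K_quaternions_closed K) (auto simp: ijkK)
  then show thesis using that z(2) intertwines by blast
qed

lemma pure_unit_sq:
  assumes "w $ 1 = 0" "nr w = 1"
  shows "w \<star> w = - quat 1 0 0 0"
proof -
  have "qconj w = - w" using assms(1) by (simp add: quat_eq_iff qconj_def)
  then have "- (w \<star> w) = quat 1 0 0 0"
    using qmult_qconj[of w] assms(2) by (simp add: qmult.minus_right)
  then show ?thesis by (metis minus_minus)
qed

lemma pure_orthogonal_anticommute:
  assumes "v $ 1 = 0" "w $ 1 = 0" "v \<bullet> w = 0"
  shows "w \<star> v = - (v \<star> w)"
  using assms by (simp add: quat_eq_iff qmult_def inner_vec_def sum_4 algebra_simps)

text \<open>
The map \<open>T = S(1)\<^sup>-\<^sup>1 S\<close> is orthogonal and fixes 1, so it permutes the pure quaternions and sends \<open>i, j\<close> to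
anticommuting square roots of -1. Both \<open>T k\<close> and \<open>T i T j\<close> are unit vectors orthogonal to \<open>1, T i, T j\<close>, hence
equal up to a sign \<open>t\<close>, the orientation of \<open>T\<close>. Composing with quaternion conjugation when \<open>t = -1\<close> makes \<open>T\<close> an
automorphism, and this does not change the image of \<open>L\<close>. Rationality over the quadratic field comes from
\<open>T i, T j, T k\<close> being combinations of images of lattice vectors.
\<close>

lemma similar_sublattice_two_sided:
  assumes S: "linear_similarity S" and sub: "S ` lattice_L \<subseteq> lattice_L"
  obtains r s where "r \<in> K_quaternions" "s \<in> K_quaternions" "r \<noteq> 0"
    "S ` lattice_L = (\<lambda>x. r \<star> x \<star> s) ` lattice_L"
proof -
  from S obtain c where lin: "linear S" and c: "c > 0" and Sin: "\<And>u v. S u \<bullet> S v = c * (u \<bullet> v)"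
    by (auto simp: linear_similarity_def)
  define i j k where ijk: "i = quat 0 1 0 0" "j = quat 0 0 1 0" "k = quat 0 0 0 1"
  define one where "one = quat 1 0 0 0"
  have inner_units: "x \<bullet> one = x $ 1" "x \<bullet> i = x $ 2" "x \<bullet> j = x $ 3" "x \<bullet> k = x $ 4" for x
    by (simp_all add: one_def ijk inner_vec_def sum_4)
  have nr_inner: "nr x = x \<bullet> x" for x by (simp add: nr_eq_norm power2_norm_eq_inner)
  define a where "a = S one"
  have nra: "nr a = c" by (simp add: nr_inner a_def Sin) (simp add: one_def inner_vec_def sum_4)
  define T where "T x = (1 / c) *\<^sub>R (qconj a \<star> S x)" for x
  have aT: "a \<star> T x = S x" for x
    using c by (simp add: T_def qmult.scaleR_right qmult_qconj_cancel nra)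
  have linT: "linear T"
    by (rule linearI) (simp_all add: T_def linear_add[OF lin] linear_scale[OF lin]
        qmult.add_right qmult.scaleR_right scaleR_add_right)
  have Tin: "T u \<bullet> T v = u \<bullet> v" for u v
    using c by (simp add: T_def inner_qmult_left nra Sin)
  have T1: "T one = one"
    using c by (simp add: T_def qmult_qconj_left nra quat_eq_iff one_def flip: a_def[unfolded one_def])
  have SK: "S x \<in> K_quaternions" if "x \<in> lattice_L" for x
    using sub that lattice_L_K_quaternions by blast
  have aK: "a \<in> K_quaternions" using SK[OF lattice_L_1] by (simp add: a_def one_def)
  then have cK: "c \<in> Q_sqrt5" using nra K_quaternions_nr by blast
  have TL: "T x \<in> K_quaternions" if "x \<in> lattice_L" for x
    unfolding T_def by (intro K_quaternions_closed aK SK that Q_sqrt5_divide cK) (simp add: Rats_imp_Q_sqrt5)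
  have T_span: "T (a *\<^sub>R lat1 + b *\<^sub>R lat2 + c *\<^sub>R lat3 + d *\<^sub>R lat4) \<in> K_quaternions"
    if "a \<in> Q_sqrt5" "b \<in> Q_sqrt5" "c \<in> Q_sqrt5" "d \<in> Q_sqrt5" for a b c d
    unfolding linear_add[OF linT] linear_scale[OF linT]
    by (intro K_quaternions_closed TL lat_in_lattice_L that)
  \<comment> \<open>The coefficients of \<open>k\<close> come from solving \<open>j + k = lat1 + 2 lat2 + lat3\<close> and \<open>(tau - 1) j - tau k = lat3 + 2 lat4\<close>.\<close>
  have ij_span: "k = ((tau - 1) / sqrt 5) *\<^sub>R lat1 + (2 * (tau - 1) / sqrt 5) *\<^sub>R lat2
      + ((tau - 2) / sqrt 5) *\<^sub>R lat3 + (- 2 / sqrt 5) *\<^sub>R lat4"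
    "i = 0 *\<^sub>R lat1 + 0 *\<^sub>R lat2 + (- 1) *\<^sub>R lat3 + 0 *\<^sub>R lat4"
    "j = 1 *\<^sub>R lat1 + 2 *\<^sub>R lat2 + 1 *\<^sub>R lat3 + 0 *\<^sub>R lat4 - k"
    by (simp_all add: quat_eq_iff lat_defs ijk field_simps) (simp_all add: sqrt5_eq)
  have QK: "0 \<in> Q_sqrt5" "1 \<in> Q_sqrt5" "2 \<in> Q_sqrt5" "-1 \<in> Q_sqrt5" "-2 \<in> Q_sqrt5"
    by (simp_all add: Rats_imp_Q_sqrt5)
  have TkK: "T k \<in> K_quaternions"
    by (subst ij_span(1), intro T_span Q_sqrt5_closed QK tau_in_Q_sqrt5 sqrt5_in_Q_sqrt5)
  have TiK: "T i \<in> K_quaternions"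
    by (subst ij_span(2), intro T_span QK)
  have TjK: "T j \<in> K_quaternions"
    by (subst ij_span(3), subst linear_diff[OF linT], intro K_quaternions_diff T_span QK TkK)
  have comp: "T x $ 1 = x $ 1" for x
    using Tin[of x one] by (simp add: T1 inner_units)
  have units: "one $ 1 = 1" "i $ 1 = 0" "j $ 1 = 0" "k $ 1 = 0" "i \<bullet> j = 0" "i \<bullet> i = 1" "j \<bullet> j = 1"
    "j \<bullet> i = 0"
    by (simp_all add: one_def ijk inner_vec_def sum_4)
  have "inj T"
  proof (rule injI)
    fix u v assume "T u = T v"
    then have "T (u - v) = 0" by (simp add: linear_diff[OF linT])
    then have "(u - v) \<bullet> (u - v) = 0" using Tin[of "u - v" "u - v"] by simp
    then show "u = v" by simp
  qed
  then have "surj T" by (rule linear_injective_imp_surjective[OF linT]) simp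
  then obtain y where y: "T y = T i \<star> T j" by (metis surjD)
  have "y $ 1 = - (T i \<bullet> T j)"
    using comp[of y] by (simp add: y qmult_def inner_vec_def sum_4 comp units)
  then have y1: "y $ 1 = 0" by (simp add: Tin units)
  have "y \<bullet> i = (T i \<star> T j) \<bullet> (T i \<star> one)"
    using Tin[of y i] by (simp add: y one_def qmult_1)
  then have y2: "y $ 2 = 0" by (simp add: inner_qmult_left inner_units comp units)
  have "y \<bullet> j = (T i \<star> T j) \<bullet> (one \<star> T j)"
    using Tin[of y j] by (simp add: y one_def qmult_1)
  then have y3: "y $ 3 = 0" by (simp add: inner_qmult_right inner_units comp units)
  have "y \<bullet> y = 1"
    using Tin[of y y] by (simp add: y inner_qmult_left nr_inner Tin units)
  then have y4: "y $ 4 * y $ 4 = 1" by (simp add: inner_vec_def sum_4 y1 y2 y3)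
  define t where "t = y $ 4"
  have t: "t * t = 1" "t = 1 \<or> t = - 1"
    using y4 by (simp_all add: t_def square_eq_1_iff)
  have "y = t *\<^sub>R k" by (simp add: quat_eq_iff y1 y2 y3 t_def ijk)
  then have TiTj: "T i \<star> T j = t *\<^sub>R T k" using y linear_scale[OF linT] by metis
  \<comment> \<open>Scaling by \<open>t\<close> corrects the orientation in both cases: \<open>v \<star> w = T i \<star> T j = t T k\<close>.\<close>
  define v w where vw: "v = t *\<^sub>R T i" "w = t *\<^sub>R T j"
  have vw_eq: "v \<star> w = t *\<^sub>R T k"
    by (simp add: vw qmult.scaleR_left qmult.scaleR_right TiTj t)
  have pure: "v $ 1 = 0" "w $ 1 = 0" by (simp_all add: vw comp units)
  have norms: "nr v = 1" "nr w = 1" by (simp_all add: vw nr_inner Tin units t)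
  have orth: "v \<bullet> w = 0" by (simp add: vw Tin units)
  have tK: "t \<in> Q_sqrt5" using t(2) QK by auto
  have vwK: "v \<in> K_quaternions" "w \<in> K_quaternions"
    by (simp_all add: vw K_quaternions_scaleR tK TiK TjK)
  obtain q where q: "q \<in> K_quaternions" "q \<noteq> 0"
    and qx: "\<And>x. q \<star> x = (quat (x $ 1) 0 0 0 + (x $ 2) *\<^sub>R v + (x $ 3) *\<^sub>R w + (x $ 4) *\<^sub>R (v \<star> w)) \<star> q"
    using quaternion_intertwiner[OF vwK pure_unit_sq[OF pure(1) norms(1)] pure_unit_sq[OF pure(2) norms(2)]
        pure_orthogonal_anticommute[OF pure orth]] by blast
  define flip where "flip x = (if t = 1 then x else qconj x)" for x
  have flip: "flip ` lattice_L = lattice_L"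
    using lattice_L_qconj by (force simp: flip_def image_iff)
  have Tflip: "T (flip x) = quat (x $ 1) 0 0 0 + (x $ 2) *\<^sub>R v + (x $ 3) *\<^sub>R w + (x $ 4) *\<^sub>R (v \<star> w)" for x
  proof -
    have "flip x = (x $ 1) *\<^sub>R one + (x $ 2 * t) *\<^sub>R i + (x $ 3 * t) *\<^sub>R j + (x $ 4 * t) *\<^sub>R k"
      using t(2) by (auto simp: flip_def quat_eq_iff qconj_def one_def ijk)
    then have "T (flip x) = (x $ 1) *\<^sub>R one + (x $ 2) *\<^sub>R v + (x $ 3) *\<^sub>R w + (x $ 4) *\<^sub>R (v \<star> w)"
      by (simp add: linear_add[OF linT] linear_scale[OF linT] T1 vw_eq) (simp add: vw)
    moreover have "(x $ 1) *\<^sub>R one = quat (x $ 1) 0 0 0" by (simp add: one_def quat_eq_iff)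
    ultimately show ?thesis by simp
  qed
  define r where "r = a \<star> q"
  define s where "s = (1 / nr q) *\<^sub>R qconj q"
  have "r \<star> x \<star> s = S (flip x)" for x
  proof -
    have "r \<star> x \<star> s = (1 / nr q) *\<^sub>R (a \<star> ((q \<star> x) \<star> qconj q))"
      by (simp add: r_def s_def qmult.scaleR_right qmult_assoc)
    also have "q \<star> x = T (flip x) \<star> q" by (simp only: Tflip qx)
    also have "(1 / nr q) *\<^sub>R (a \<star> (T (flip x) \<star> q \<star> qconj q)) = a \<star> T (flip x)"
      using q(2) by (simp add: qmult_qconj_cancel qmult.scaleR_right nr_eq_0_iff)
    finally show ?thesis by (simp add: aT)
  qed
  then have "S ` lattice_L = (\<lambda>x. r \<star> x \<star> s) ` lattice_L"
    using flip by (metis (no_types, lifting) image_cong image_image)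
  moreover have "r \<in> K_quaternions" "s \<in> K_quaternions"
    by (simp_all add: r_def s_def K_quaternions_closed aK q Q_sqrt5_divide QK K_quaternions_nr)
  moreover have "r \<noteq> 0"
    using c nra q(2) nr_eq_0_iff[of a] by (auto simp: r_def qmult_eq_0_iff)
  ultimately show thesis using that by blast
qed

lemma commutes_with_L_imp_scalar:
  assumes "\<And>x. x \<in> lattice_L \<Longrightarrow> d \<star> x = x \<star> d"
  shows "d = quat (d $ 1) 0 0 0"
  using assms[OF lat_in_lattice_L(3)] assms[OF lat_in_lattice_L(2)]
  by (simp add: quat_eq_iff qmult_def lat_defs)

text \<open>
Comparing \<open>r x s\<close> with its twist \<open>twist(s) x twist(r)\<close> shows that \<open>r\<^sup>-\<^sup>1 twist(s)\<close> commutes with all of \<open>L\<close> and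
is therefore a scalar. So \<open>s\<close> is a multiple \<open>c\<close> of \<open>twist(r)\<close>, and as both \<open>r twist(r)\<close> and \<open>r s\<close> are fixed by the
twist, \<open>c\<close> is fixed by conjugation.
\<close>

lemma two_sided_imp_twisted:
  assumes r: "r \<in> K_quaternions" "r \<noteq> 0" and s: "s \<in> K_quaternions"
    and sub: "\<And>x. x \<in> lattice_L \<Longrightarrow> r \<star> x \<star> s \<in> lattice_L"
  obtains c where "c \<in> \<rat>" "s = c *\<^sub>R twist r"
proof -
  define d where "d = qconj r \<star> twist s"
  define n where "n = nr r"
  define m where "m = nr (twist r)"
  have nm: "n \<noteq> 0" "m \<noteq> 0" "n \<in> Q_sqrt5"
    using r by (simp_all add: n_def m_def nr_eq_0_iff twist_eq_0_iff K_quaternions_nr)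
  have eq: "m *\<^sub>R (d \<star> x) = n *\<^sub>R (x \<star> (s \<star> qconj (twist r)))" if x: "x \<in> lattice_L" for x
  proof -
    have "twist s \<star> (x \<star> twist r) = r \<star> x \<star> s"
      using lattice_L_twist[OF sub[OF x]] lattice_L_twist[OF x] r s lattice_L_K_quaternions[OF x]
      by (simp add: twist_qmult K_quaternions_closed)
    then have "qconj r \<star> (twist s \<star> (x \<star> twist r)) \<star> qconj (twist r)
        = qconj r \<star> (r \<star> x \<star> s) \<star> qconj (twist r)" by simp
    moreover have "qconj r \<star> (twist s \<star> (x \<star> twist r)) \<star> qconj (twist r) = m *\<^sub>R (d \<star> x)"
      by (simp add: d_def m_def qmult_assoc qmult_qconj qmult_scalar qmult.scaleR_right)
    moreover have "qconj r \<star> (r \<star> x \<star> s) \<star> qconj (twist r) = n *\<^sub>R (x \<star> (s \<star> qconj (twist r)))"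
      by (simp add: n_def qmult_assoc qmult_qconj_cancel qmult.scaleR_left)
    ultimately show ?thesis by simp
  qed
  have "d \<star> x = x \<star> d" if "x \<in> lattice_L" for x
  proof -
    have "m *\<^sub>R (d \<star> x) = x \<star> (n *\<^sub>R (s \<star> qconj (twist r)))"
      using eq[OF that] by (simp add: qmult.scaleR_right)
    also have "n *\<^sub>R (s \<star> qconj (twist r)) = m *\<^sub>R d"
      using eq[OF lattice_L_1] by (simp add: qmult_1)
    finally show ?thesis using nm by (simp add: qmult.scaleR_right)
  qed
  then have d: "d = quat (d $ 1) 0 0 0" by (rule commutes_with_L_imp_scalar)
  define c where "c = galois (d $ 1 / n)"
  have dK: "d \<in> K_quaternions" using r s by (simp add: d_def K_quaternions_closed)
  then have dn: "d $ 1 / n \<in> Q_sqrt5" using nm by (simp add: K_quaternions_iff Q_sqrt5_divide)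
  then have cK: "c \<in> Q_sqrt5" by (simp add: c_def galois_in_Q_sqrt5)
  have "r \<star> d = n *\<^sub>R twist s" by (simp add: d_def n_def qmult_qconj_cancel)
  then have "n *\<^sub>R twist s = (d $ 1) *\<^sub>R r" using d qmult_scalar(2)[of r "d $ 1"] by simp
  then have "(1 / n) *\<^sub>R (n *\<^sub>R twist s) = (1 / n) *\<^sub>R ((d $ 1) *\<^sub>R r)" by simp
  then have "twist s = (d $ 1 / n) *\<^sub>R r" using nm by simp
  then have sc: "s = c *\<^sub>R twist r"
    using twist_twist[OF s] dn r by (simp add: c_def twist_scaleR)
  define h where "h = r \<star> quat 1 0 0 0 \<star> twist r"
  have h: "h \<in> K_quaternions" "twist h = h" "h \<noteq> 0"
  proof -
    have "quat 1 0 0 0 \<in> K_quaternions" "twist (quat 1 0 0 0) = quat 1 0 0 0"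
      using lattice_L_1 by (simp_all add: lattice_L_K_quaternions lattice_L_twist)
    then show "h \<in> K_quaternions" "twist h = h"
      using r by (simp_all add: h_def K_quaternions_closed twisted_conjugate_fixed)
    show "h \<noteq> 0" using r by (simp add: h_def qmult_eq_0_iff qmult_1 twist_eq_0_iff)
  qed
  have "c *\<^sub>R h \<in> lattice_L"
    using sub[OF lattice_L_1] by (simp add: sc h_def qmult.scaleR_right)
  then have "galois c *\<^sub>R h = c *\<^sub>R h"
    using lattice_L_twist twist_scaleR[OF cK h(1)] h(2) by metis
  then have "galois c = c" using h(3) by simp
  then have "c \<in> \<rat>" using cK by (intro galois_fixed_imp_Rats)
  then show thesis using that sc by blast
qed

lemma primitive_SSLs_imp_twisted:
  assumes "\<Lambda> \<in> primitive_SSLs"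
  obtains p where "primitive_icosian p" "\<Lambda> = twisted_sublattice p"
proof -
  obtain S where S: "linear_similarity S" "S ` lattice_L \<subseteq> lattice_L" "\<Lambda> = S ` lattice_L"
    and prim: "primitive_sublattice \<Lambda>"
    using assms by (auto simp: primitive_SSLs_def similar_sublattice_def)
  obtain r s where r: "r \<in> K_quaternions" "r \<noteq> 0" and s: "s \<in> K_quaternions"
    and \<Lambda>: "\<Lambda> = (\<lambda>x. r \<star> x \<star> s) ` lattice_L"
    using similar_sublattice_two_sided[OF S(1,2)] S(3) by metis
  have sub: "\<Lambda> \<subseteq> lattice_L" using S by simp
  then have "r \<star> x \<star> s \<in> lattice_L" if "x \<in> lattice_L" for x using that \<Lambda> by blast
  then obtain c where c: "c \<in> \<rat>" "s = c *\<^sub>R twist r"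
    using two_sided_imp_twisted[OF r s] by blast
  obtain k q where k: "k \<in> Q_sqrt5" and q: "primitive_icosian q" and rk: "r = k *\<^sub>R q"
    using K_quaternion_primitive_multiple[OF r] by metis
  have qI: "q \<in> icosians" using q by (simp add: primitive_icosian_def)
  define e where "e = c * field_norm k"
  have "r \<star> x \<star> s = e *\<^sub>R (q \<star> x \<star> twist q)" for x
    using twisted_conjugate_scaleR[OF k icosians_imp_K_quaternions[OF qI], of x]
    by (simp add: c(2) rk e_def qmult.scaleR_right)
  then have \<Lambda>e: "\<Lambda> = (*\<^sub>R) e ` twisted_sublattice q"
    by (simp add: \<Lambda> twisted_sublattice_def image_image)
  have qsub: "twisted_sublattice q \<subseteq> lattice_L"
    using qI by (auto simp: twisted_sublattice_def lattice_L_twisted_conjugate)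
  have "e \<in> \<int>"
  proof (rule primitive_sublattice_rational_multiple[OF primitive_sublattice_twisted[OF q] qsub])
    show "e \<in> \<rat>" using c k by (simp add: e_def field_norm_in_Rats)
  qed (use sub \<Lambda>e in auto)
  then obtain m :: int where m: "e = of_int m" by (rule Ints_cases)
  have "m \<noteq> 0"
  proof
    assume "m = 0"
    then have "\<Lambda> \<subseteq> (*\<^sub>R) (real 2) ` lattice_L"
      using lattice_L_diff[OF lattice_L_1 lattice_L_1] by (auto simp: \<Lambda>e m image_iff)
    then show False using prim[unfolded primitive_sublattice_def, rule_format, of 2] by simp
  qed
  have minus: "- x \<in> twisted_sublattice q" if x: "x \<in> twisted_sublattice q" for x
  proof -
    obtain l where "l \<in> lattice_L" "x = q \<star> l \<star> twist q" using x by (auto simp: twisted_sublattice_def)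
    then show ?thesis using lattice_L_scaleR[of "-1" l]
      unfolding twisted_sublattice_def
      by (intro image_eqI[of _ _ "- l"]) (simp_all add: qmult.minus_left qmult.minus_right)
  qed
  have "\<Lambda> \<subseteq> (*\<^sub>R) (real (nat \<bar>m\<bar>)) ` lattice_L"
  proof
    fix x assume "x \<in> \<Lambda>"
    then obtain z where z: "z \<in> twisted_sublattice q" "x = e *\<^sub>R z" by (auto simp: \<Lambda>e)
    then have "x = real (nat \<bar>m\<bar>) *\<^sub>R (if m < 0 then - z else z)" by (simp add: m)
    moreover have "(if m < 0 then - z else z) \<in> lattice_L" using z minus qsub by auto
    ultimately show "x \<in> (*\<^sub>R) (real (nat \<bar>m\<bar>)) ` lattice_L" by blast
  qed
  then have "nat \<bar>m\<bar> = 1"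
    using prim \<open>m \<noteq> 0\<close> unfolding primitive_sublattice_def by simp
  then have "e = 1 \<or> e = - 1" by (auto simp: m)
  then have "\<Lambda> = twisted_sublattice q"
    unfolding \<Lambda>e using minus by (force simp: image_iff)
  then show thesis using that q by blast
qed

section \<open>Indices of additive subgroups\<close>

definition add_subgroup :: "quat set \<Rightarrow> bool" where
  "add_subgroup G \<longleftrightarrow> 0 \<in> G \<and> (\<forall>x\<in>G. \<forall>y\<in>G. x - y \<in> G)"

lemma add_subgroup_add: "add_subgroup G \<Longrightarrow> x \<in> G \<Longrightarrow> y \<in> G \<Longrightarrow> x + y \<in> G"
  unfolding add_subgroup_def by (metis diff_0 diff_minus_eq_add)

lemma add_subgroup_diff: "add_subgroup G \<Longrightarrow> x \<in> G \<Longrightarrow> y \<in> G \<Longrightarrow> x - y \<in> G"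
  by (simp add: add_subgroup_def)

lemma add_subgroup_diff_commute: "add_subgroup G \<Longrightarrow> x - y \<in> G \<Longrightarrow> y - x \<in> G"
  unfolding add_subgroup_def by (metis diff_0 minus_diff_eq)

definition transversal :: "quat set \<Rightarrow> quat set \<Rightarrow> quat set \<Rightarrow> bool" where
  "transversal R G H \<longleftrightarrow> R \<subseteq> G \<and> (\<forall>x\<in>G. \<exists>!r. r \<in> R \<and> x - r \<in> H)"

lemma coset_eq_iff:
  assumes "add_subgroup H"
  shows "(+) x ` H = (+) y ` H \<longleftrightarrow> x - y \<in> H"
proof
  assume "(+) x ` H = (+) y ` H"
  moreover have "x \<in> (+) x ` H" using assms by (force simp: add_subgroup_def)
  ultimately have "x \<in> (+) y ` H" by simp
  then show "x - y \<in> H" by auto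
next
  have sub: "(+) x ` H \<subseteq> (+) y ` H" if "x - y \<in> H" for x y
  proof
    fix z assume "z \<in> (+) x ` H"
    then obtain h where "h \<in> H" "z = x + h" by auto
    then show "z \<in> (+) y ` H"
      using add_subgroup_add[OF assms that] by (intro image_eqI[of _ _ "(x - y) + h"]) auto
  qed
  assume "x - y \<in> H"
  then show "(+) x ` H = (+) y ` H"
    using sub add_subgroup_diff_commute[OF assms] by blast
qed

lemma add_index_transversal:
  assumes H: "add_subgroup H" and R: "transversal R G H"
  shows "add_index G H = card R"
proof -
  have "bij_betw (\<lambda>r. (+) r ` H) R ((\<lambda>x. (+) x ` H) ` G)"
    unfolding bij_betw_def
  proof
    show "inj_on (\<lambda>r. (+) r ` H) R"
    proof (rule inj_onI)
      fix r s assume rs: "r \<in> R" "s \<in> R" "(+) r ` H = (+) s ` H"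
      then have "r - s \<in> H" "r - r \<in> H" "r \<in> G"
        using H R by (auto simp: coset_eq_iff add_subgroup_def transversal_def)
      then show "r = s" using R rs unfolding transversal_def by blast
    qed
    have "(+) x ` H \<in> (\<lambda>r. (+) r ` H) ` R" if "x \<in> G" for x
      using R that H by (auto simp: transversal_def image_iff coset_eq_iff)
    then show "(\<lambda>r. (+) r ` H) ` R = (\<lambda>x. (+) x ` H) ` G"
      using R by (auto simp: transversal_def)
  qed
  then show ?thesis unfolding add_index_def by (simp add: bij_betw_same_card)
qed

lemma transversal_exists:
  assumes H: "add_subgroup H"
  obtains R where "transversal R G H"
proof -
  define rep where "rep x = (SOME y. y \<in> G \<and> x - y \<in> H)" for x
  have rep: "rep x \<in> G \<and> x - rep x \<in> H" if "x \<in> G" for x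
    unfolding rep_def
    by (rule someI[of "\<lambda>y. y \<in> G \<and> x - y \<in> H" x]) (use that H in \<open>simp add: add_subgroup_def\<close>)
  have unique: "r = rep x" if "x \<in> G" and r: "r \<in> rep ` G" "x - r \<in> H" for x r
  proof -
    obtain a where a: "a \<in> G" "r = rep a" using r(1) by auto
    have "a - r \<in> H" using rep[OF a(1)] a(2) by simp
    then have "(x - r) - (a - r) \<in> H" using add_subgroup_diff[OF H r(2)] by blast
    then have "x - a \<in> H" by simp
    then have "(+) x ` H = (+) a ` H" by (simp add: coset_eq_iff[OF H])
    then have "x - y \<in> H \<longleftrightarrow> a - y \<in> H" for y by (simp flip: coset_eq_iff[OF H])
    then have "rep x = rep a" unfolding rep_def by presburger
    then show ?thesis using a(2) by simp
  qed
  have "transversal (rep ` G) G H"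
    unfolding transversal_def
  proof (intro conjI ballI)
    show "rep ` G \<subseteq> G" using rep by auto
    fix x assume x: "x \<in> G"
    show "\<exists>!r. r \<in> rep ` G \<and> x - r \<in> H"
      by (rule ex1I[of _ "rep x"]) (use rep[OF x] unique[OF x] x in auto)
  qed
  then show thesis by (rule that)
qed

text \<open>
Sums of representatives of \<open>G/H\<close> and \<open>H/K\<close> represent \<open>G/K\<close>. The value 0 for infinite indices is consistent with
the product formula, because \<open>card\<close> of a product is multiplicative for infinite sets as well.
\<close>

lemma add_index_tower:
  assumes G: "add_subgroup G" and H: "add_subgroup H" and K: "add_subgroup K"
    and sub: "K \<subseteq> H" "H \<subseteq> G"
  shows "add_index G K = add_index G H * add_index H K"
proof -
  obtain R where R: "transversal R G H" using transversal_exists[OF H] by blast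
  obtain S where S: "transversal S H K" using transversal_exists[OF K] by blast
  have RG: "R \<subseteq> G" and SH: "S \<subseteq> H" using R S by (auto simp: transversal_def)
  have unique: "r = r' \<and> s = s'"
    if "r \<in> R" "r' \<in> R" "s \<in> S" "s' \<in> S" "(r + s) - (r' + s') \<in> K" for r r' s s'
  proof -
    have "(r - r') + (s - s') \<in> H" using that(5) sub by (auto simp: algebra_simps)
    moreover have "s - s' \<in> H" using that SH by (intro add_subgroup_diff[OF H]) auto
    ultimately have "r - r' \<in> H" using add_subgroup_diff[OF H] by fastforce
    moreover have "r - r \<in> H" using H by (simp add: add_subgroup_def)
    ultimately have "r = r'" using R that RG unfolding transversal_def by blast
    then have "s - s' \<in> K" using that by simp
    moreover have "s - s \<in> K" using K by (simp add: add_subgroup_def)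
    ultimately have "s = s'" using S that SH unfolding transversal_def by blast
    with \<open>r = r'\<close> show ?thesis by simp
  qed
  have "transversal ((\<lambda>(r, s). r + s) ` (R \<times> S)) G K"
    unfolding transversal_def
  proof (intro conjI ballI)
    show "(\<lambda>(r, s). r + s) ` (R \<times> S) \<subseteq> G"
      using RG SH sub by (auto intro!: add_subgroup_add[OF G])
    fix x assume "x \<in> G"
    then obtain r where r: "r \<in> R" "x - r \<in> H" using R unfolding transversal_def by blast
    then obtain s where s: "s \<in> S" "x - r - s \<in> K" using S unfolding transversal_def by blast
    show "\<exists>!t. t \<in> (\<lambda>(r, s). r + s) ` (R \<times> S) \<and> x - t \<in> K"
    proof (intro ex1I conjI)
      show "r + s \<in> (\<lambda>(r, s). r + s) ` (R \<times> S)" using r s by auto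
      show x: "x - (r + s) \<in> K" using s by (simp add: algebra_simps)
      fix t assume t: "t \<in> (\<lambda>(r, s). r + s) ` (R \<times> S) \<and> x - t \<in> K"
      then obtain r' s' where rs': "r' \<in> R" "s' \<in> S" "t = r' + s'" by auto
      have "(r + s) - (r' + s') \<in> K"
        using add_subgroup_diff[OF K _ x, of "x - t"] t unfolding rs'(3) by (simp add: algebra_simps)
      then show "t = r + s" using unique r s rs' by blast
    qed
  qed
  then have "add_index G K = card ((\<lambda>(r, s). r + s) ` (R \<times> S))"
    by (rule add_index_transversal[OF K])
  also have "inj_on (\<lambda>(r, s). r + s) (R \<times> S)"
  proof (rule inj_onI, clarify)
    fix r s r' s' assume "r \<in> R" "s \<in> S" "r' \<in> R" "s' \<in> S" "r + s = r' + s'"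
    then show "r = r' \<and> s = s'" using unique[of r r' s s'] K by (simp add: add_subgroup_def)
  qed
  then have "card ((\<lambda>(r, s). r + s) ` (R \<times> S)) = card R * card S"
    by (simp add: card_image card_cartesian_product)
  finally show ?thesis
    using add_index_transversal[OF H R] add_index_transversal[OF K S] by simp
qed

text \<open>
Additivity on \<open>G\<close> only, so that the twist is covered: it is additive merely on quaternions over the
quadratic field.
\<close>

definition additive_inj_on :: "quat set \<Rightarrow> (quat \<Rightarrow> quat) \<Rightarrow> bool" where
  "additive_inj_on G f \<longleftrightarrow> inj_on f G \<and> (\<forall>x\<in>G. \<forall>y\<in>G. f (x - y) = f x - f y)"

lemma add_subgroup_image:
  assumes "add_subgroup H" "H \<subseteq> G" "additive_inj_on G f"
  shows "add_subgroup (f ` H)"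
proof -
  have diff: "f (x - y) = f x - f y" if "x \<in> H" "y \<in> H" for x y
    using that assms by (auto simp: additive_inj_on_def)
  have "0 \<in> H" using assms by (simp add: add_subgroup_def)
  then have "f 0 = 0" using diff[of 0 0] by simp
  then have "0 \<in> f ` H" using \<open>0 \<in> H\<close> by (metis imageI)
  moreover have "f x - f y \<in> f ` H" if "x \<in> H" "y \<in> H" for x y
    using diff[OF that] add_subgroup_diff[OF assms(1) that] by (metis imageI)
  ultimately show ?thesis by (auto simp: add_subgroup_def)
qed

lemma add_index_image:
  assumes G: "add_subgroup G" and H: "add_subgroup H" "H \<subseteq> G" and f: "additive_inj_on G f"
  shows "add_index (f ` G) (f ` H) = add_index G H"
proof -
  obtain R where R: "transversal R G H" using transversal_exists[OF H(1)] by blast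
  then have RG: "R \<subseteq> G" by (simp add: transversal_def)
  have iff: "f x - f r \<in> f ` H \<longleftrightarrow> x - r \<in> H" if "x \<in> G" "r \<in> G" for x r
  proof -
    have "f x - f r = f (x - r)" "x - r \<in> G"
      using f that G by (simp_all add: additive_inj_on_def add_subgroup_def)
    moreover have "f (x - r) \<in> f ` H \<longleftrightarrow> x - r \<in> H"
      using f H(2) \<open>x - r \<in> G\<close> unfolding additive_inj_on_def by (metis inj_on_image_mem_iff)
    ultimately show ?thesis by simp
  qed
  have "transversal (f ` R) (f ` G) (f ` H)"
    unfolding transversal_def
  proof (intro conjI ballI)
    show "f ` R \<subseteq> f ` G" using RG by auto
    fix z assume "z \<in> f ` G"
    then obtain x where x: "x \<in> G" "z = f x" by auto
    then obtain r where r: "r \<in> R" "x - r \<in> H" and u: "\<And>s. s \<in> R \<Longrightarrow> x - s \<in> H \<Longrightarrow> s = r"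
      using R unfolding transversal_def by blast
    show "\<exists>!r. r \<in> f ` R \<and> z - r \<in> f ` H"
    proof (intro ex1I conjI)
      show "f r \<in> f ` R" using r by simp
      show "z - f r \<in> f ` H" using iff[of x r] x r RG by blast
      fix t assume t: "t \<in> f ` R \<and> z - t \<in> f ` H"
      then obtain s where s: "s \<in> R" "t = f s" by auto
      then have "x - s \<in> H" using iff[of x s] t x RG by blast
      then show "t = f r" using u s by blast
    qed
  qed
  then have "add_index (f ` G) (f ` H) = card (f ` R)"
    by (rule add_index_transversal[OF add_subgroup_image[OF H f]])
  also have "\<dots> = card R"
    using f RG unfolding additive_inj_on_def by (metis card_image inj_on_subset)
  finally show ?thesis using add_index_transversal[OF H(1) R] by simp
qed

lemma add_index_compose:
  assumes G: "add_subgroup G" and f: "additive_inj_on G f" "f ` G \<subseteq> G"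
    and g: "additive_inj_on G g" "g ` G \<subseteq> G"
  shows "add_index G ((\<lambda>x. f (g x)) ` G) = add_index G (f ` G) * add_index G (g ` G)"
proof -
  have gG: "add_subgroup (g ` G)" by (rule add_subgroup_image[OF G _ g(1)]) simp
  have "add_index G (f ` g ` G) = add_index G (f ` G) * add_index (f ` G) (f ` g ` G)"
    by (rule add_index_tower[OF G add_subgroup_image[OF G _ f(1)] add_subgroup_image[OF gG g(2) f(1)]])
      (use f g in auto)
  also have "add_index (f ` G) (f ` g ` G) = add_index G (g ` G)"
    by (rule add_index_image[OF G gG g(2) f(1)])
  finally show ?thesis by (simp add: image_image)
qed

text \<open>
Both compositions \<open>t \<circ> f\<close> and \<open>g \<circ> t\<close> have the same index, and the finite index of \<open>t\<close> cancels.
\<close>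

lemma add_index_conjugate:
  assumes G: "add_subgroup G"
    and f: "additive_inj_on G f" "f ` G \<subseteq> G" and g: "additive_inj_on G g" "g ` G \<subseteq> G"
    and t: "additive_inj_on G t" "t ` G \<subseteq> G" "add_index G (t ` G) \<noteq> 0"
    and eq: "\<And>x. x \<in> G \<Longrightarrow> t (f x) = g (t x)"
  shows "add_index G (f ` G) = add_index G (g ` G)"
proof -
  have "(\<lambda>x. t (f x)) ` G = (\<lambda>x. g (t x)) ` G" using eq by (rule image_cong[OF refl])
  then show ?thesis
    using add_index_compose[OF G t(1,2) f] add_index_compose[OF G g t(1,2)] t(3) by simp
qed

text \<open>
The index of \<open>n G\<close> in \<open>G\<close>, computed coordinatewise from representatives \<open>D\<close> of the coefficients modulo \<open>n\<close>. It
applies to the icosians and to the lattice alike, with coefficients in \<open>Z_tau\<close> and in the integers.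
\<close>

lemma add_index_scaleR_span4:
  fixes n :: nat
  assumes indep: "\<And>a b c d. a *\<^sub>R u + b *\<^sub>R v + c *\<^sub>R w + d *\<^sub>R z = 0 \<Longrightarrow> a = 0 \<and> b = 0 \<and> c = 0 \<and> d = 0"
    and R: "0 \<in> R" "\<And>x y. x \<in> R \<Longrightarrow> y \<in> R \<Longrightarrow> x - y \<in> R"
    and D: "D \<subseteq> R" "\<And>x. x \<in> R \<Longrightarrow> \<exists>!d. d \<in> D \<and> (\<exists>y\<in>R. x - d = real n * y)"
  shows "add_index (span4 R u v w z) ((*\<^sub>R) (real n) ` span4 R u v w z) = card D ^ 4"
proof -
  define \<phi> where "\<phi> = (\<lambda>(a, b, c, d). a *\<^sub>R u + b *\<^sub>R v + c *\<^sub>R w + d *\<^sub>R z)"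
  define G where "G = span4 R u v w z"
  have G: "G = \<phi> ` (R \<times> R \<times> R \<times> R)"
  proof
    show "G \<subseteq> \<phi> ` (R \<times> R \<times> R \<times> R)"
    proof
      fix x assume "x \<in> G"
      then obtain a b c d where x: "x = a *\<^sub>R u + b *\<^sub>R v + c *\<^sub>R w + d *\<^sub>R z"
        and r: "a \<in> R" "b \<in> R" "c \<in> R" "d \<in> R" unfolding G_def span4_def by blast
      show "x \<in> \<phi> ` (R \<times> R \<times> R \<times> R)"
        by (rule image_eqI[of _ _ "(a, b, c, d)"]) (simp_all add: \<phi>_def x r)
    qed
    show "\<phi> ` (R \<times> R \<times> R \<times> R) \<subseteq> G"
      unfolding G_def span4_def \<phi>_def by auto
  qed
  have \<phi>_diff: "\<phi> (a, b, c, d) - \<phi> (a', b', c', d') = \<phi> (a - a', b - b', c - c', d - d')"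
    for a b c d a' b' c' d' by (simp add: \<phi>_def algebra_simps)
  have \<phi>_scale: "real n *\<^sub>R \<phi> (a, b, c, d) = \<phi> (real n * a, real n * b, real n * c, real n * d)"
    for a b c d by (simp add: \<phi>_def algebra_simps)
  have \<phi>_inj: "a = a' \<and> b = b' \<and> c = c' \<and> d = d'" if "\<phi> (a, b, c, d) = \<phi> (a', b', c', d')"
    for a b c d a' b' c' d'
    using indep[of "a - a'" "b - b'" "c - c'" "d - d'"] that \<phi>_diff[of a b c d a' b' c' d']
    by (simp add: \<phi>_def)
  have G_sub: "add_subgroup G"
    unfolding add_subgroup_def
  proof (intro conjI ballI)
    show "0 \<in> G" unfolding G by (rule image_eqI[of _ _ "(0, 0, 0, 0)"]) (simp_all add: \<phi>_def R)
    fix x y assume "x \<in> G" "y \<in> G"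
    then show "x - y \<in> G" unfolding G by (auto simp: \<phi>_diff intro!: imageI R)
  qed
  have nG: "add_subgroup ((*\<^sub>R) (real n) ` G)"
    using G_sub unfolding add_subgroup_def
    by (auto simp: image_iff simp flip: scaleR_diff_right)
  have "transversal (\<phi> ` (D \<times> D \<times> D \<times> D)) G ((*\<^sub>R) (real n) ` G)"
    unfolding transversal_def
  proof (intro conjI ballI)
    show "\<phi> ` (D \<times> D \<times> D \<times> D) \<subseteq> G" unfolding G using D(1) by (intro image_mono) auto
    fix x assume "x \<in> G"
    then obtain a b c d where x: "x = \<phi> (a, b, c, d)" "a \<in> R" "b \<in> R" "c \<in> R" "d \<in> R"
      by (auto simp: G)
    have iff: "x - \<phi> (a', b', c', d') \<in> (*\<^sub>R) (real n) ` G \<longleftrightarrow>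
        (\<exists>y\<in>R. a - a' = real n * y) \<and> (\<exists>y\<in>R. b - b' = real n * y) \<and>
        (\<exists>y\<in>R. c - c' = real n * y) \<and> (\<exists>y\<in>R. d - d' = real n * y)" for a' b' c' d'
    proof
      assume "x - \<phi> (a', b', c', d') \<in> (*\<^sub>R) (real n) ` G"
      then obtain y1 y2 y3 y4 where y: "y1 \<in> R" "y2 \<in> R" "y3 \<in> R" "y4 \<in> R"
        "\<phi> (a - a', b - b', c - c', d - d') = \<phi> (real n * y1, real n * y2, real n * y3, real n * y4)"
        by (auto simp: G x(1) \<phi>_diff \<phi>_scale)
      show "(\<exists>y\<in>R. a - a' = real n * y) \<and> (\<exists>y\<in>R. b - b' = real n * y) \<and>
        (\<exists>y\<in>R. c - c' = real n * y) \<and> (\<exists>y\<in>R. d - d' = real n * y)"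
        using \<phi>_inj[OF y(5)] y(1-4) by blast
    next
      assume "(\<exists>y\<in>R. a - a' = real n * y) \<and> (\<exists>y\<in>R. b - b' = real n * y) \<and>
        (\<exists>y\<in>R. c - c' = real n * y) \<and> (\<exists>y\<in>R. d - d' = real n * y)"
      then obtain y1 y2 y3 y4 where y: "y1 \<in> R" "y2 \<in> R" "y3 \<in> R" "y4 \<in> R"
        "a - a' = real n * y1" "b - b' = real n * y2" "c - c' = real n * y3" "d - d' = real n * y4"
        by blast
      then have "x - \<phi> (a', b', c', d') = real n *\<^sub>R \<phi> (y1, y2, y3, y4)"
        by (simp add: x(1) \<phi>_diff \<phi>_scale)
      then show "x - \<phi> (a', b', c', d') \<in> (*\<^sub>R) (real n) ` G" using y by (auto simp: G)
    qed
    obtain a' where a': "a' \<in> D" "\<exists>y\<in>R. a - a' = real n * y"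
      "\<And>e. e \<in> D \<Longrightarrow> \<exists>y\<in>R. a - e = real n * y \<Longrightarrow> e = a'" using D(2)[OF x(2)] by blast
    obtain b' where b': "b' \<in> D" "\<exists>y\<in>R. b - b' = real n * y"
      "\<And>e. e \<in> D \<Longrightarrow> \<exists>y\<in>R. b - e = real n * y \<Longrightarrow> e = b'" using D(2)[OF x(3)] by blast
    obtain c' where c': "c' \<in> D" "\<exists>y\<in>R. c - c' = real n * y"
      "\<And>e. e \<in> D \<Longrightarrow> \<exists>y\<in>R. c - e = real n * y \<Longrightarrow> e = c'" using D(2)[OF x(4)] by blast
    obtain d' where d': "d' \<in> D" "\<exists>y\<in>R. d - d' = real n * y"
      "\<And>e. e \<in> D \<Longrightarrow> \<exists>y\<in>R. d - e = real n * y \<Longrightarrow> e = d'" using D(2)[OF x(5)] by blast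
    show "\<exists>!r. r \<in> \<phi> ` (D \<times> D \<times> D \<times> D) \<and> x - r \<in> (*\<^sub>R) (real n) ` G"
    proof (intro ex1I conjI)
      show "\<phi> (a', b', c', d') \<in> \<phi> ` (D \<times> D \<times> D \<times> D)" using a'(1) b'(1) c'(1) d'(1) by auto
      show "x - \<phi> (a', b', c', d') \<in> (*\<^sub>R) (real n) ` G"
        unfolding iff using a'(2) b'(2) c'(2) d'(2) by blast
      fix r assume r: "r \<in> \<phi> ` (D \<times> D \<times> D \<times> D) \<and> x - r \<in> (*\<^sub>R) (real n) ` G"
      then obtain e1 e2 e3 e4 where e: "e1 \<in> D" "e2 \<in> D" "e3 \<in> D" "e4 \<in> D" "r = \<phi> (e1, e2, e3, e4)"
        by auto
      have "x - \<phi> (e1, e2, e3, e4) \<in> (*\<^sub>R) (real n) ` G" using r e(5) by simp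
      then have "e1 = a'" "e2 = b'" "e3 = c'" "e4 = d'"
        unfolding iff using a'(3)[OF e(1)] b'(3)[OF e(2)] c'(3)[OF e(3)] d'(3)[OF e(4)] by blast+
      then show "r = \<phi> (a', b', c', d')" using e(5) by simp
    qed
  qed
  then have "add_index G ((*\<^sub>R) (real n) ` G) = card (\<phi> ` (D \<times> D \<times> D \<times> D))"
    by (rule add_index_transversal[OF nG])
  also have "\<dots> = card (D \<times> D \<times> D \<times> D)"
    by (rule card_image) (use \<phi>_inj in \<open>fastforce intro: inj_onI\<close>)
  also have "\<dots> = card D ^ 4" by (simp add: card_cartesian_product power4_eq_xxxx)
  finally show ?thesis by (simp add: G_def)
qed

lemma Ints_residue_unique:
  fixes x :: real
  assumes x: "x \<in> \<int>" and n: "n > 0"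
  shows "\<exists>!d. d \<in> real ` {..<n} \<and> (\<exists>y\<in>\<int>. x - d = real n * y)"
proof -
  obtain k where k: "x = of_int k" using x by (rule Ints_cases)
  define m where "m = nat (k mod int n)"
  have m: "int m = k mod int n" "m < n" using n by (simp_all add: m_def nat_less_iff)
  show ?thesis
  proof (rule ex1I[of _ "real m"])
    have "k - int m = int n * (k div int n)" using m by (simp add: minus_mod_eq_mult_div)
    then have "of_int (k - int m) = (of_int (int n * (k div int n)) :: real)" by simp
    then have "x - real m = real n * of_int (k div int n)" using k by simp
    then show "real m \<in> real ` {..<n} \<and> (\<exists>y\<in>\<int>. x - real m = real n * y)"
      using m(2) by (auto intro!: bexI[of _ "of_int (k div int n)"])
    fix d assume "d \<in> real ` {..<n} \<and> (\<exists>y\<in>\<int>. x - d = real n * y)"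
    then obtain l i where l: "d = real l" "l < n" "x - d = real n * of_int i"
      by (auto elim!: Ints_cases)
    have "of_int (k - int l) = (of_int (int n * i) :: real)" using l k by simp
    then have "k - int l = int n * i" by (simp only: of_int_eq_iff)
    then have "k mod int n = int l mod int n" by (simp add: mod_eq_dvd_iff)
    then have "int l = int m" using l(2) m(1) by simp
    then show "d = real m" using l by simp
  qed
qed

lemma Z_tau_residue_unique:
  assumes x: "x \<in> Z_tau" and n: "n > 0"
  shows "\<exists>!d. d \<in> (\<lambda>(a, b). real a + real b * tau) ` ({..<n} \<times> {..<n})
    \<and> (\<exists>y\<in>Z_tau. x - d = real n * y)"
proof -
  obtain a b where ab: "a \<in> \<int>" "b \<in> \<int>" "x = a + b * tau" using x by (rule Z_tau_E)
  obtain k where k: "k < n" "\<exists>y\<in>\<int>. a - real k = real n * y"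
    "\<And>d. d \<in> real ` {..<n} \<Longrightarrow> \<exists>y\<in>\<int>. a - d = real n * y \<Longrightarrow> d = real k"
    using Ints_residue_unique[OF ab(1) n] by blast
  obtain l where l: "l < n" "\<exists>y\<in>\<int>. b - real l = real n * y"
    "\<And>d. d \<in> real ` {..<n} \<Longrightarrow> \<exists>y\<in>\<int>. b - d = real n * y \<Longrightarrow> d = real l"
    using Ints_residue_unique[OF ab(2) n] by blast
  show ?thesis
  proof (intro ex1I conjI)
    show "real k + real l * tau \<in> (\<lambda>(a, b). real a + real b * tau) ` ({..<n} \<times> {..<n})"
      using k(1) l(1) by auto
    obtain y z where yz: "y \<in> \<int>" "z \<in> \<int>" "a - real k = real n * y" "b - real l = real n * z"
      using k(2) l(2) by blast
    have "x - (real k + real l * tau) = (a - real k) + (b - real l) * tau"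
      by (simp add: ab(3) algebra_simps)
    also have "\<dots> = real n * (y + z * tau)" unfolding yz by (simp add: algebra_simps)
    finally show "\<exists>y\<in>Z_tau. x - (real k + real l * tau) = real n * y"
      using Z_tau_I[OF yz(1,2)] by blast
    fix d assume d: "d \<in> (\<lambda>(a, b). real a + real b * tau) ` ({..<n} \<times> {..<n})
      \<and> (\<exists>y\<in>Z_tau. x - d = real n * y)"
    then obtain i j where ij: "i < n" "j < n" "d = real i + real j * tau" by auto
    from d obtain y' where "y' \<in> Z_tau" "x - d = real n * y'" by blast
    then obtain s t where st: "s \<in> \<int>" "t \<in> \<int>" "x - d = real n * (s + t * tau)"
      by (metis Z_tau_E)
    have "(a - real i) + (b - real j) * tau = real n * s + (real n * t) * tau"
      using st(3) by (simp add: ab(3) ij(3) algebra_simps)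
    moreover have "a - real i \<in> \<rat>" "b - real j \<in> \<rat>" "real n * s \<in> \<rat>" "real n * t \<in> \<rat>"
      using ab st by (simp_all add: Ints_imp_Rats)
    ultimately have "a - real i = real n * s" "b - real j = real n * t"
      by (blast dest: tau_coordinates_unique)+
    then have "real i = real k" "real j = real l"
      using k(3)[of "real i"] l(3)[of "real j"] ij st by blast+
    then show "d = real k + real l * tau" using ij by simp
  qed
qed

lemma add_index_lattice_L_scaleR:
  assumes "n > 0"
  shows "add_index lattice_L ((*\<^sub>R) (real n) ` lattice_L) = n ^ 4"
proof -
  have "add_index lattice_L ((*\<^sub>R) (real n) ` lattice_L) = card (real ` {..<n}) ^ 4"
    unfolding lattice_L_def
  proof (rule add_index_scaleR_span4)
    fix a b c d
    assume 0: "a *\<^sub>R quat 1 0 0 0 + b *\<^sub>R (1/2) *\<^sub>R quat (- 1) 1 1 1 + c *\<^sub>R quat 0 (- 1) 0 0 +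
      d *\<^sub>R (1/2) *\<^sub>R quat 0 1 (tau - 1) (- tau) = 0"
    then have "b + d * (tau - 1) = 0" "b - d * tau = 0" by (auto simp: quat_eq_iff field_simps)
    then have "d * sqrt 5 = 0" unfolding sqrt5_eq by (simp add: algebra_simps)
    then have "d = 0" by simp
    then show "a = 0 \<and> b = 0 \<and> c = 0 \<and> d = 0" using 0 by (auto simp: quat_eq_iff)
  qed (use Ints_residue_unique[OF _ assms] in auto)
  then show ?thesis by (simp add: card_image)
qed

lemma add_index_icosians_scaleR_nat:
  assumes "n > 0"
  shows "add_index icosians ((*\<^sub>R) (real n) ` icosians) = n ^ 8"
proof -
  let ?D = "(\<lambda>(a, b). real a + real b * tau) ` ({..<n} \<times> {..<n})"
  have "inj_on (\<lambda>(a, b). real a + real b * tau) ({..<n} \<times> {..<n})"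
    by (rule inj_onI) (auto dest: tau_coordinates_unique[rotated -1])
  then have "card ?D = n * n" by (simp add: card_image card_cartesian_product)
  moreover have "add_index icosians ((*\<^sub>R) (real n) ` icosians) = card ?D ^ 4"
    unfolding icosians_def
  proof (rule add_index_scaleR_span4)
    fix a b c d
    assume "a *\<^sub>R quat 1 0 0 0 + b *\<^sub>R quat 0 1 0 0 + c *\<^sub>R (1/2) *\<^sub>R quat 1 1 1 1 +
      d *\<^sub>R (1/2) *\<^sub>R quat (1 - tau) tau 0 1 = 0"
    then show "a = 0 \<and> b = 0 \<and> c = 0 \<and> d = 0" by (auto simp: quat_eq_iff)
  next
    show "?D \<subseteq> Z_tau" by (auto intro!: Z_tau_I)
  qed (use Z_tau_residue_unique[OF _ assms] in \<open>simp_all add: Z_tau_diff\<close>)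
  ultimately show ?thesis by (simp add: power_mult_distrib flip: power_add)
qed

section \<open>Indices of principal ideals and of twisted sublattices\<close>

lemma add_subgroup_icosians: "add_subgroup icosians" and add_subgroup_lattice_L: "add_subgroup lattice_L"
  using lattice_L_diff[OF lattice_L_1 lattice_L_1]
  by (simp_all add: add_subgroup_def icosians_0 icosians_diff lattice_L_diff)

lemma additive_inj_on_scaleR: "a \<noteq> 0 \<Longrightarrow> additive_inj_on G ((*\<^sub>R) a)"
  by (auto simp: additive_inj_on_def algebra_simps inj_on_def)

lemma additive_inj_on_qmult: "p \<noteq> 0 \<Longrightarrow> additive_inj_on G ((\<star>) p)"
proof -
  assume p: "p \<noteq> 0"
  have "x = y" if "p \<star> x = p \<star> y" for x y
  proof -
    have "p \<star> (x - y) = 0" using that by (simp add: qmult.diff_right)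
    then show ?thesis using p by (simp add: qmult_eq_0_iff)
  qed
  then show ?thesis by (auto simp: additive_inj_on_def inj_on_def qmult.diff_right)
qed

lemma additive_inj_on_twisted:
  assumes "p \<in> K_quaternions" "p \<noteq> 0"
  shows "additive_inj_on G (\<lambda>x. p \<star> x \<star> twist p)"
proof -
  have "x = y" if "p \<star> x \<star> twist p = p \<star> y \<star> twist p" for x y
  proof -
    have "p \<star> (x - y) \<star> twist p = 0"
      using that by (simp add: qmult.diff_right qmult.diff_left)
    then show ?thesis using assms by (simp add: qmult_eq_0_iff twist_eq_0_iff)
  qed
  then show ?thesis by (auto simp: additive_inj_on_def inj_on_def qmult.diff_right qmult.diff_left)
qed

lemma field_norm_nr_nat:
  assumes "p \<in> icosians" "p \<noteq> 0"
  obtains n where "n > 0" "field_norm (nr p) = real n"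
proof -
  have pK: "p \<in> K_quaternions" using assms by (simp add: icosians_imp_K_quaternions)
  have "field_norm (nr p) = nr p * nr (twist p)"
    using pK by (simp add: field_norm_def nr_twist)
  then have "field_norm (nr p) > 0" using assms pK by (simp add: nr_pos twist_eq_0_iff)
  moreover obtain i where "field_norm (nr p) = of_int i"
    using field_norm_in_Ints[OF icosians_nr[OF assms(1)]] by (rule Ints_cases)
  ultimately show thesis using that[of "nat i"] by simp
qed

text \<open>
The twist maps \<open>a I\<close> onto \<open>a' I\<close>, so conjugate scalars have the same index, and their product is the
integer \<open>n\<close>, of index \<open>n\<^sup>8\<close>.
\<close>

lemma add_index_icosians_scaleR:
  assumes a: "a \<in> Z_tau" and n: "field_norm a = real n" "n > 0"
  shows "add_index icosians ((*\<^sub>R) a ` icosians) = n ^ 4"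
proof -
  have a0: "a \<noteq> 0" "galois a \<noteq> 0" using n by (auto simp: field_norm_def)
  have aK: "a \<in> Q_sqrt5" using a by (rule Z_tau_imp_Q_sqrt5)
  have tw: "twist ` icosians = icosians"
    using icosians_twist twist_twist[OF icosians_imp_K_quaternions] by (force simp: image_iff)
  have "additive_inj_on icosians twist"
    unfolding additive_inj_on_def
    by (metis icosians_imp_K_quaternions inj_onI twist_diff twist_twist)
  moreover have "(*\<^sub>R) a ` icosians \<subseteq> icosians" using a by (auto simp: icosians_scaleR)
  ultimately have "add_index (twist ` icosians) (twist ` (*\<^sub>R) a ` icosians) = add_index icosians ((*\<^sub>R) a ` icosians)"
    by (intro add_index_image[OF add_subgroup_icosians]
        add_subgroup_image[OF add_subgroup_icosians subset_refl additive_inj_on_scaleR[OF a0(1)]])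
  moreover have "twist ` (*\<^sub>R) a ` icosians = (*\<^sub>R) (galois a) ` twist ` icosians"
    unfolding image_image using aK icosians_imp_K_quaternions
    by (intro image_cong) (auto simp: twist_scaleR)
  ultimately have "add_index icosians ((*\<^sub>R) (galois a) ` icosians) = add_index icosians ((*\<^sub>R) a ` icosians)"
    by (simp add: tw)
  moreover have "add_index icosians ((\<lambda>x. a *\<^sub>R (galois a *\<^sub>R x)) ` icosians)
      = add_index icosians ((*\<^sub>R) a ` icosians) * add_index icosians ((*\<^sub>R) (galois a) ` icosians)"
    by (rule add_index_compose[OF add_subgroup_icosians])
      (use a a0 in \<open>auto simp: additive_inj_on_scaleR icosians_scaleR Z_tau_galois\<close>)
  moreover have "(\<lambda>x::quat. a *\<^sub>R (galois a *\<^sub>R x)) = (*\<^sub>R) (real n)"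
    using n(1) by (simp add: field_norm_def fun_eq_iff)
  ultimately have "(add_index icosians ((*\<^sub>R) a ` icosians))\<^sup>2 = (n ^ 4)\<^sup>2"
    using add_index_icosians_scaleR_nat[OF n(2)] by (simp add: power2_eq_square flip: power_add)
  then show ?thesis by (rule power2_eq_imp_eq) simp_all
qed

text \<open>
A pure quaternion \<open>t\<close> orthogonal to the vector part of \<open>p\<close> anticommutes with that vector part. For
\<open>p = (p0, p1, p2, p3)\<close> the choice \<open>(0, 2 p2, -2 p1, 0)\<close> has integral components; if it vanishes, the vector
part is a multiple of \<open>k\<close> and \<open>t = i\<close> does it.
\<close>

lemma icosian_intertwines_conjugate:
  assumes "p \<in> icosians"
  obtains t where "t \<in> icosians" "t \<noteq> 0" "t \<star> p = qconj p \<star> t"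
proof (cases "p $ 2 = 0 \<and> p $ 3 = 0")
  case True
  have "quat 0 1 0 0 \<in> icosians" using icosians_ico(2) by (simp add: ico2_def)
  moreover have "quat 0 1 0 0 \<noteq> 0" by (simp add: quat_eq_iff)
  moreover have "quat 0 1 0 0 \<star> p = qconj p \<star> quat 0 1 0 0"
    using True by (simp add: quat_eq_iff qmult_def qconj_def)
  ultimately show thesis by (rule that)
next
  case False
  have "trd (p \<star> quat 0 1 0 0) \<in> Z_tau" "trd (p \<star> quat 0 0 1 0) \<in> Z_tau"
    by (intro icosians_trd icosians_qmult assms icosians_quat; simp)+
  then have "quat 0 (- trd (p \<star> quat 0 0 1 0)) (trd (p \<star> quat 0 1 0 0)) 0 \<in> icosians"
    by (intro icosians_quat Z_tau_minus) simp_all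
  then have "quat 0 (2 * p $ 3) (- 2 * p $ 2) 0 \<in> icosians" by (simp add: trd_def qmult_def)
  moreover have "quat 0 (2 * p $ 3) (- 2 * p $ 2) 0 \<noteq> 0" using False by (auto simp: quat_eq_iff)
  moreover have "quat 0 (2 * p $ 3) (- 2 * p $ 2) 0 \<star> p = qconj p \<star> quat 0 (2 * p $ 3) (- 2 * p $ 2) 0"
    by (simp add: quat_eq_iff qmult_def qconj_def)
  ultimately show thesis by (rule that)
qed

lemma add_index_conj_ideals_product:
  assumes p: "p \<in> icosians" "p \<noteq> 0" and n: "field_norm (nr p) = real n" "n > 0"
  shows "add_index icosians ((\<star>) p ` icosians) * add_index icosians ((\<star>) (qconj p) ` icosians) = n ^ 4"
proof -
  have p': "qconj p \<in> icosians" "qconj p \<noteq> 0"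
    using p by (auto simp: icosians_qconj simp flip: nr_eq_0_iff)
  have "add_index icosians ((\<lambda>x. p \<star> (qconj p \<star> x)) ` icosians)
      = add_index icosians ((\<star>) p ` icosians) * add_index icosians ((\<star>) (qconj p) ` icosians)"
    by (rule add_index_compose[OF add_subgroup_icosians])
      (use p p' in \<open>auto simp: additive_inj_on_qmult icosians_qmult\<close>)
  then show ?thesis
    using add_index_icosians_scaleR[OF icosians_nr[OF p(1)] n] by (simp add: qmult_qconj_cancel)
qed

lemma add_index_principal_right_ideal:
  assumes p: "p \<in> icosians" "p \<noteq> 0" and n: "field_norm (nr p) = real n" "n > 0"
  shows "add_index icosians (principal_right_ideal p) = n\<^sup>2"
proof -
  have p': "qconj p \<in> icosians" "qconj p \<noteq> 0"
    using p by (auto simp: icosians_qconj simp flip: nr_eq_0_iff)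
  obtain t where t: "t \<in> icosians" "t \<noteq> 0" "t \<star> p = qconj p \<star> t"
    using icosian_intertwines_conjugate[OF p(1)] by blast
  obtain m where m: "m > 0" "field_norm (nr t) = real m" using field_norm_nr_nat[OF t(1,2)] by blast
  have "add_index icosians ((\<star>) t ` icosians) \<noteq> 0"
    using add_index_conj_ideals_product[OF t(1,2) m(2,1)] m(1) by (metis mult_is_0 power_not_zero not_gr0)
  then have "add_index icosians ((\<star>) p ` icosians) = add_index icosians ((\<star>) (qconj p) ` icosians)"
    by (intro add_index_conjugate[OF add_subgroup_icosians, where t = "(\<star>) t"])
      (use p p' t in \<open>auto simp: additive_inj_on_qmult icosians_qmult simp flip: qmult_assoc\<close>)
  then have "(add_index icosians ((\<star>) p ` icosians))\<^sup>2 = (n\<^sup>2)\<^sup>2"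
    using add_index_conj_ideals_product[OF p n] by (simp add: power2_eq_square power4_eq_xxxx)
  then have "add_index icosians ((\<star>) p ` icosians) = n\<^sup>2"
    by (rule power2_eq_imp_eq) simp_all
  then show ?thesis by (simp add: principal_right_ideal_def)
qed

lemma add_index_conj_twisted_product:
  assumes p: "p \<in> icosians" "p \<noteq> 0" and n: "field_norm (nr p) = real n" "n > 0"
  shows "add_index lattice_L (twisted_sublattice p) * add_index lattice_L (twisted_sublattice (qconj p)) = n ^ 4"
proof -
  have p': "qconj p \<in> icosians" "qconj p \<noteq> 0"
    using p by (auto simp: icosians_qconj simp flip: nr_eq_0_iff)
  have "add_index lattice_L ((\<lambda>x. qconj p \<star> (p \<star> x \<star> twist p) \<star> twist (qconj p)) ` lattice_L)
      = add_index lattice_L (twisted_sublattice (qconj p)) * add_index lattice_L (twisted_sublattice p)"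
    unfolding twisted_sublattice_def
    by (rule add_index_compose[OF add_subgroup_lattice_L])
      (use p p' in \<open>auto simp: additive_inj_on_twisted icosians_imp_K_quaternions lattice_L_twisted_conjugate\<close>)
  then show ?thesis
    using add_index_lattice_L_scaleR[OF n(2)] p n(1)
    by (simp add: twisted_conjugate_conjugate icosians_imp_K_quaternions mult.commute)
qed

lemma add_index_twisted_sublattice:
  assumes p: "p \<in> icosians" "p \<noteq> 0" and n: "field_norm (nr p) = real n" "n > 0"
  shows "add_index lattice_L (twisted_sublattice p) = n\<^sup>2"
proof -
  have p': "qconj p \<in> icosians" "qconj p \<noteq> 0"
    using p by (auto simp: icosians_qconj simp flip: nr_eq_0_iff)
  obtain t where t: "t \<in> icosians" "t \<noteq> 0" "t \<star> p = qconj p \<star> t"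
    using icosian_intertwines_conjugate[OF p(1)] by blast
  obtain m where m: "m > 0" "field_norm (nr t) = real m" using field_norm_nr_nat[OF t(1,2)] by blast
  have t_ind: "add_index lattice_L ((\<lambda>x. t \<star> x \<star> twist t) ` lattice_L) \<noteq> 0"
    using add_index_conj_twisted_product[OF t(1,2) m(2,1)] m(1) unfolding twisted_sublattice_def
    by (metis mult_is_0 power_not_zero not_gr0)
  have "t \<star> (p \<star> x \<star> twist p) \<star> twist t = qconj p \<star> (t \<star> x \<star> twist t) \<star> twist (qconj p)" for x
  proof -
    have "t \<star> (p \<star> x \<star> twist p) \<star> twist t = (t \<star> p) \<star> x \<star> twist (t \<star> p)"
      using p t(1) by (simp add: twist_qmult icosians_imp_K_quaternions qmult_assoc)
    also have "\<dots> = qconj p \<star> (t \<star> x \<star> twist t) \<star> twist (qconj p)"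
      unfolding t(3) using p' t(1) by (simp add: twist_qmult icosians_imp_K_quaternions qmult_assoc)
    finally show ?thesis .
  qed
  then have "add_index lattice_L (twisted_sublattice p) = add_index lattice_L (twisted_sublattice (qconj p))"
    unfolding twisted_sublattice_def
    by (intro add_index_conjugate[OF add_subgroup_lattice_L _ _ _ _ _ _ t_ind])
      (use p p' t in \<open>auto simp: additive_inj_on_twisted icosians_imp_K_quaternions lattice_L_twisted_conjugate\<close>)
  then have "(add_index lattice_L (twisted_sublattice p))\<^sup>2 = (n\<^sup>2)\<^sup>2"
    using add_index_conj_twisted_product[OF p n] by (simp add: power2_eq_square power4_eq_xxxx)
  then show ?thesis by (rule power2_eq_imp_eq) simp_all
qed

section \<open>The correspondence\<close>

theorem proposition4:
  shows "(\<exists>f. bij_betw f primitive_right_ideals primitive_SSLs \<and>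
            (\<forall>p. primitive_icosian p \<longrightarrow>
               principal_right_ideal p \<in> primitive_right_ideals \<and>
               f (principal_right_ideal p) = twisted_sublattice p)) \<and>
         (\<forall>p. primitive_icosian p \<longrightarrow>
            real (add_index icosians (principal_right_ideal p)) = field_norm ((nr p)\<^sup>2) \<and>
            field_norm ((nr p)\<^sup>2) = field_norm (norm p ^ 4) \<and>
            field_norm (norm p ^ 4) = real (add_index lattice_L (twisted_sublattice p)))"
proof (intro conjI allI impI)
  define f where "f J = twisted_sublattice (SOME p. primitive_icosian p \<and> J = principal_right_ideal p)" for J
  have f: "f (principal_right_ideal p) = twisted_sublattice p" if p: "primitive_icosian p" for p
  proof -
    define q where "q = (SOME q. primitive_icosian q \<and> principal_right_ideal p = principal_right_ideal q)"
    have "primitive_icosian q \<and> principal_right_ideal p = principal_right_ideal q"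
      unfolding q_def by (rule someI[of _ p]) (simp add: p)
    then have "twisted_sublattice p = twisted_sublattice q"
      using twisted_sublattice_eq_iff p by blast
    then show ?thesis by (simp add: f_def q_def)
  qed
  have ideal: "principal_right_ideal p \<in> primitive_right_ideals" if "primitive_icosian p" for p
    using that right_ideal_principal unfolding primitive_right_ideals_def primitive_icosian_def by blast
  have ideals: "primitive_right_ideals = principal_right_ideal ` Collect primitive_icosian"
    using ideal by (auto simp: primitive_right_ideals_def)
  have "bij_betw f primitive_right_ideals primitive_SSLs"
    unfolding bij_betw_def
  proof
    show "inj_on f primitive_right_ideals"
      unfolding ideals by (rule inj_onI) (auto simp: f twisted_sublattice_eq_iff)
    have "\<Lambda> \<in> f ` primitive_right_ideals" if "\<Lambda> \<in> primitive_SSLs" for \<Lambda>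
      using primitive_SSLs_imp_twisted[OF that] f ideal by (metis imageI)
    then show "f ` primitive_right_ideals = primitive_SSLs"
      unfolding ideals by (auto simp: f twisted_sublattice_in_primitive_SSLs)
  qed
  then show "\<exists>f. bij_betw f primitive_right_ideals primitive_SSLs \<and>
      (\<forall>p. primitive_icosian p \<longrightarrow> principal_right_ideal p \<in> primitive_right_ideals \<and>
        f (principal_right_ideal p) = twisted_sublattice p)"
    using f ideal by blast
next
  fix p assume "primitive_icosian p"
  then have p: "p \<in> icosians" "p \<noteq> 0"
    using primitive_icosian_imp_nonzero by (auto simp: primitive_icosian_def)
  obtain n where n: "n > 0" "field_norm (nr p) = real n" using field_norm_nr_nat[OF p] by blast
  have "nr p \<in> Q_sqrt5" by (intro Z_tau_imp_Q_sqrt5 icosians_nr p)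
  then have norm: "field_norm ((nr p)\<^sup>2) = real (n\<^sup>2)"
    using n by (simp add: power2_eq_square field_norm_mult)
  show "real (add_index icosians (principal_right_ideal p)) = field_norm ((nr p)\<^sup>2)"
    using add_index_principal_right_ideal[OF p n(2,1)] norm by simp
  show "field_norm ((nr p)\<^sup>2) = field_norm (norm p ^ 4)"
    by (simp add: nr_eq_norm flip: power_mult)
  then show "field_norm (norm p ^ 4) = real (add_index lattice_L (twisted_sublattice p))"
    using add_index_twisted_sublattice[OF p n(2,1)] norm by simp
qed

end
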